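(* Let $S$ be a symmetry group in dimension $d$ and let $(G,p)\in\mathscr{R}_{(G,S)}$ be a framework in $\mathbb{E}^d$. If $p$ is an $S$-regular point of $G$, and the cone framework $(G*o,q)$ in $\mathbb{E}^{d+1}$ (with cone joint $o$ at the origin) has symmetry $S^{*}$, with $\pi(q)=p$, then $(G,p)$ has an $S$-symmetric finite flex if and only if $(G*o,q)$ has an $S^{*}$-symmetric finite flex.
   Context: A framework $(G,p)$ in $\mathbb{E}^d$ is a finite simple graph $G$ with vertex set $V(G)=\{1,\dots,n\}$ and edge set $E(G)$, together with an injective map $p:V(G)\to\mathbb{E}^d$, identified with a point (configuration) of $\mathbb{E}^{dn}$; $p_i=p(i)$. The edge function is $f_G:\mathbb{E}^{dn}\to\mathbb{R}^{|E(G)|}$, $f_G(p)=(\|p_i-p_j\|^2)_{\{i,j\}\in E(G)}$; $K_n$ denotes the complete graph on $V(G)$. A finite motion of $(G,p)$ is an analytic path $y:[0,1]\to\mathbb{E}^{dn}$ with $y(0)=p$ and $f_G(y(t))=f_G(p)$ for all $t$. It is a finite flex (non-trivial finite motion) if $f_{K_n}(y(t))\ne f_{K_n}(p)$ for all $t\in(0,1]$. A symmetry group in dimension $d$ is a subgroup $S$ of $O(\mathbb{E}^d)$. $\mathscr{R}_{(G,S)}$ is the set of frameworks $(G,p)$ in $\mathbb{E}^d$ for which there is a map $\Phi:S\to\mathrm{Aut}(G)$ with $x(p_i)=p_{\Phi(x)(i)}$ for all $i\in V(G)$, $x\in S$; $\Phi$, the type of $(G,p)$, is unique and a homomorphism since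 $p$ is injective. $\mathscr{P}_{(G,S,\Phi)}$ is the linear subspace of all configurations in $\mathbb{E}^{dn}$ satisfying these equations, and $\tilde f_G$ is the restriction of $f_G$ to it. For $(G,p)\in\mathscr{R}_{(G,S)}$ of type $\Phi$, $p$ is an $S$-regular point of $G$ if $\operatorname{rank} d\tilde f_G(p)=\max\{\operatorname{rank} d\tilde f_G(p'):p'\in\mathscr{P}_{(G,S,\Phi)}\}$. An $S$-symmetric finite flex of $(G,p)$ is a finite flex $y$ preserving the symmetry throughout the path, i.e. $y(t)\in\mathscr{P}_{(G,S,\Phi)}$ for all $t\in[0,1]$. For $x\in S$ with matrix $M_x$, $x^*$ is the transformation of $\mathbb{E}^{d+1}$ with matrix $\begin{pmatrix}M_x&0\\0&1\end{pmatrix}$, and $S^*=\{x^*:x\in S\}$. The cone graph $G*o$ is $G$ with a new vertex $o$ joined to all vertices of $G$. "$(G*o,q)$ has symmetry $S^*$" means $(G*o,q)\in\mathscr{R}_{(G*o,S^* )}$. The condition $\pi(q)=p$ means that for each $i\in V(G)$ there is a scalar $\alpha_i\ne0$ with $q_i=\alpha_i(p_i,1)$ (projection from the origin onto the hyperplane $x_{d+1}=1$, then back to $\mathbb{E}^d$). *)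

theory Defs
  imports "HOL-Analysis.Analysis" "HOL-Algebra.Group"
begin

text \<open>
  The Euclidean space \<open>E\<^sup>d\<close> is an arbitrary type \<open>'a::euclidean_space\<close> with \<open>DIM('a) = d\<close>, and
  \<open>E\<^sup>d\<^sup>+\<^sup>1\<close> is \<open>'a \<times> real\<close>, whose norm is the Euclidean one.  The vertex set is a finite type \<open>'v\<close>,
  so that configurations are the points of the Euclidean space \<open>'a ^ 'v\<close>; a graph is given by
  its set of edges, which are two-element sets of vertices.
\<close>

section \<open>Graphs and frameworks\<close>

definition simple_graph :: "'v::finite set set \<Rightarrow> bool" where
  "simple_graph E \<longleftrightarrow> (\<forall>e\<in>E. card e = 2)"

definition complete_graph :: "'v::finite set set" where
  "complete_graph = {e. card e = 2}"

definition graph_aut :: "'v::finite set set \<Rightarrow> ('v \<Rightarrow> 'v) set" where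
  "graph_aut E = {\<sigma>. bij \<sigma> \<and> (\<forall>i j. {\<sigma> i, \<sigma> j} \<in> E \<longleftrightarrow> {i, j} \<in> E)}"

definition framework :: "'v::finite set set \<Rightarrow> 'a::euclidean_space ^ 'v \<Rightarrow> bool" where
  "framework E p \<longleftrightarrow> simple_graph E \<and> inj (\<lambda>i. p $ i)"

definition sq_length :: "'a::euclidean_space ^ 'v::finite \<Rightarrow> 'v set \<Rightarrow> real" where
  "sq_length p e = (THE l. \<exists>i j. e = {i, j} \<and> l = (norm (p $ i - p $ j))\<^sup>2)"

lemma sq_length_edge: "sq_length p {i, j} = (norm (p $ i - p $ j))\<^sup>2"
  unfolding sq_length_def
  by (rule the_equality) (auto simp: doubleton_eq_iff norm_minus_commute)

text \<open>
  The space \<open>\<real>\<^bsup>E\<^esup>\<close> is embedded in \<open>real ^ 'v set\<close> as the subspace of the vectors vanishing outside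
  of \<open>E\<close>; neither equality of values nor the rank of the differential is affected by this.
\<close>

definition edge_function ::
    "'v::finite set set \<Rightarrow> 'a::euclidean_space ^ 'v \<Rightarrow> real ^ 'v set" where
  "edge_function E p = (\<chi> e. if e \<in> E then sq_length p e else 0)"


section \<open>Symmetric frameworks\<close>

definition orthogonal_group :: "('a::euclidean_space \<Rightarrow> 'a) monoid" where
  "orthogonal_group =
     \<lparr>carrier = {x. orthogonal_transformation x}, mult = (\<circ>), one = id\<rparr>"

definition symmetry_group :: "('a::euclidean_space \<Rightarrow> 'a) set \<Rightarrow> bool" where
  "symmetry_group S \<longleftrightarrow> subgroup S orthogonal_group"

definition symmetric_configs ::
    "('a::euclidean_space \<Rightarrow> 'a) set \<Rightarrow> (('a \<Rightarrow> 'a) \<Rightarrow> 'v::finite \<Rightarrow> 'v) \<Rightarrow> ('a ^ 'v) set" where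
  "symmetric_configs S \<Phi> = {p. \<forall>x\<in>S. \<forall>i. x (p $ i) = p $ (\<Phi> x i)}"

text \<open>
  \<open>symmetric_framework E S \<Phi> p\<close> says that the framework is in \<open>\<R>\<^bsub>(G,S)\<^esub>\<close> with type \<open>\<Phi>\<close>.  Only the
  values of \<open>\<Phi>\<close> on \<open>S\<close> matter, and these are determined by the injectivity of \<open>p\<close>.
\<close>

definition symmetric_framework ::
    "'v::finite set set \<Rightarrow> ('a::euclidean_space \<Rightarrow> 'a) set \<Rightarrow> (('a \<Rightarrow> 'a) \<Rightarrow> 'v \<Rightarrow> 'v) \<Rightarrow>
     'a ^ 'v \<Rightarrow> bool" where
  "symmetric_framework E S \<Phi> p \<longleftrightarrow>
     framework E p \<and> \<Phi> \<in> S \<rightarrow> graph_aut E \<and> p \<in> symmetric_configs S \<Phi>"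

lemma symmetric_framework_type_unique:
  assumes "symmetric_framework E S \<Phi> p" "symmetric_framework E S \<Psi> p" "x \<in> S"
  shows "\<Phi> x = \<Psi> x"
proof
  fix i
  have "p $ (\<Phi> x i) = p $ (\<Psi> x i)"
    using assms by (simp add: symmetric_framework_def symmetric_configs_def)
  then show "\<Phi> x i = \<Psi> x i"
    using assms(1) by (auto simp: symmetric_framework_def framework_def dest: injD)
qed

text \<open>
  The derivative of \<open>edge_function E\<close> within the subspace of symmetric configurations is only
  determined on this subspace, where it is the differential of the restricted edge function.
\<close>

definition symmetric_rank ::
    "'v::finite set set \<Rightarrow> ('a::euclidean_space \<Rightarrow> 'a) set \<Rightarrow> (('a \<Rightarrow> 'a) \<Rightarrow> 'v \<Rightarrow> 'v) \<Rightarrow>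
     'a ^ 'v \<Rightarrow> nat" where
  "symmetric_rank E S \<Phi> p =
     dim (frechet_derivative (edge_function E) (at p within symmetric_configs S \<Phi>)
            ` symmetric_configs S \<Phi>)"

definition S_regular ::
    "'v::finite set set \<Rightarrow> ('a::euclidean_space \<Rightarrow> 'a) set \<Rightarrow> (('a \<Rightarrow> 'a) \<Rightarrow> 'v \<Rightarrow> 'v) \<Rightarrow>
     'a ^ 'v \<Rightarrow> bool" where
  "S_regular E S \<Phi> p \<longleftrightarrow>
     symmetric_rank E S \<Phi> p = Max (symmetric_rank E S \<Phi> ` symmetric_configs S \<Phi>)"


section \<open>Finite flexes\<close>

text \<open>
  Real analyticity on a set of reals, as local representability by power series in the points
  of the set.  For a closed interval this is the existence of an analytic extension to an open
  neighbourhood: a one-sided expansion at an end point converges on both sides of it.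
\<close>

definition real_analytic_on :: "(real \<Rightarrow> 'b::real_normed_vector) \<Rightarrow> real set \<Rightarrow> bool" where
  "real_analytic_on y A \<longleftrightarrow>
     (\<forall>a\<in>A. \<exists>r>0. \<exists>c. \<forall>t\<in>A. \<bar>t - a\<bar> < r \<longrightarrow> (\<lambda>k. (t - a) ^ k *\<^sub>R c k) sums y t)"

definition finite_motion ::
    "'v::finite set set \<Rightarrow> 'a::euclidean_space ^ 'v \<Rightarrow> (real \<Rightarrow> 'a ^ 'v) \<Rightarrow> bool" where
  "finite_motion E p y \<longleftrightarrow>
     real_analytic_on y {0..1} \<and> y 0 = p \<and>
     (\<forall>t\<in>{0..1}. edge_function E (y t) = edge_function E p)"

definition finite_flex ::
    "'v::finite set set \<Rightarrow> 'a::euclidean_space ^ 'v \<Rightarrow> (real \<Rightarrow> 'a ^ 'v) \<Rightarrow> bool" where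
  "finite_flex E p y \<longleftrightarrow>
     finite_motion E p y \<and>
     (\<forall>t\<in>{0<..1}. edge_function complete_graph (y t) \<noteq> edge_function complete_graph p)"

definition symmetric_finite_flex ::
    "'v::finite set set \<Rightarrow> ('a::euclidean_space \<Rightarrow> 'a) set \<Rightarrow> (('a \<Rightarrow> 'a) \<Rightarrow> 'v \<Rightarrow> 'v) \<Rightarrow>
     'a ^ 'v \<Rightarrow> (real \<Rightarrow> 'a ^ 'v) \<Rightarrow> bool" where
  "symmetric_finite_flex E S \<Phi> p y \<longleftrightarrow>
     finite_flex E p y \<and> (\<forall>t\<in>{0..1}. y t \<in> symmetric_configs S \<Phi>)"


section \<open>Coning\<close>

text \<open>The cone vertex is \<open>None\<close>.\<close>

definition cone_graph :: "'v::finite set set \<Rightarrow> 'v option set set" where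
  "cone_graph E = (\<lambda>e. Some ` e) ` E \<union> range (\<lambda>i. {None, Some i})"

text \<open>The block matrix with blocks \<open>M\<^sub>x\<close> and \<open>1\<close> acts on \<open>'a \<times> real\<close> by \<open>(v, s) \<mapsto> (x v, s)\<close>.\<close>

definition cone_map :: "('a::euclidean_space \<Rightarrow> 'a) \<Rightarrow> 'a \<times> real \<Rightarrow> 'a \<times> real" where
  "cone_map x = map_prod x id"

definition cone_group ::
    "('a::euclidean_space \<Rightarrow> 'a) set \<Rightarrow> ('a \<times> real \<Rightarrow> 'a \<times> real) set" where
  "cone_group S = cone_map ` S"

definition projects_to ::
    "('a::euclidean_space \<times> real) ^ 'v::finite option \<Rightarrow> 'a ^ 'v \<Rightarrow> bool" where
  "projects_to q p \<longleftrightarrow> (\<forall>i. \<exists>\<alpha>. \<alpha> \<noteq> 0 \<and> q $ Some i = \<alpha> *\<^sub>R (p $ i, 1))"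

end

theory Submission
  imports Defs "HOL-Complex_Analysis.Cauchy_Integral_Formula"
begin

text \<open>
  Both frameworks are treated by one infinitesimal criterion (\<open>symmetric_finite_flex_iff\<close>): at a
  configuration whose space of symmetric infinitesimal motions has locally minimal dimension, a
  symmetric finite flex exists if and only if some symmetric infinitesimal motion is not induced by
  a symmetry-preserving Euclidean motion.  If all of them are trivial, they extend to trivial
  motions of the nearby symmetric configurations, where by semicontinuity of the rank there are no
  others (\<open>no_symmetric_finite_flex\<close>).  Conversely, a nontrivial one is integrated to an analytic path
  (\<open>symmetric_finite_flex_exists\<close>); since the edge function is quadratic, this is a quadratic fixed
  point equation that is solved by a power series (\<open>quadratic_fixed_point_series\<close>).  The path is a
  genuine flex because the velocity of a path of congruent configurations is always trivial
  (\<open>trivial_inf_motion_of_congruent_path\<close>).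

  The cone is compared with the base infinitesimally.  If \<open>q\<^sub>i = h\<^sub>i (p\<^sub>i, 1)\<close> and the cone vertex
  rests at the origin, then \<open>u\<^sub>i \<mapsto> h\<^sub>i (u\<^sub>i, - p\<^sub>i \<bullet> u\<^sub>i)\<close> maps the symmetric infinitesimal motions of the
  base bijectively to those of the cone (\<open>cone_lift_in_symmetric_inf_motions_iff\<close>, \<open>cone_lift_surj\<close>), and
  the trivial ones to the trivial ones.  As this holds at all configurations near \<open>q\<close>, regularity of \<open>p\<close>
  carries over to \<open>q\<close> (\<open>dim_symmetric_inf_motions_cone\<close>), and the criterion gives the same answer for
  both.
\<close>

section \<open>Linear algebra\<close>

lemma dim_kernel_plus_dim_image:
  fixes f :: "'a::euclidean_space \<Rightarrow> 'b::euclidean_space"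
  assumes f: "linear f" and S: "subspace S"
  shows "dim {x \<in> S. f x = 0} + dim (f ` S) = dim S"
proof -
  interpret f: linear f by (fact f)
  define K where "K = {x \<in> S. f x = 0}"
  define N where "N = {y \<in> S. \<forall>x\<in>K. orthogonal x y}"
  have K: "subspace K"
    using S unfolding K_def subspace_def by (auto simp: f.add f.scaleR)
  have N: "subspace N"
    using S unfolding N_def subspace_def
    by (auto simp: orthogonal_clauses)
  have "dim N + dim K = dim S"
    unfolding N_def using dim_subspace_orthogonal_to_vectors[OF K S] by (auto simp: K_def)
  moreover have "f ` N = f ` S"
  proof
    show "f ` N \<subseteq> f ` S" by (auto simp: N_def)
    show "f ` S \<subseteq> f ` N"
    proof
      fix y assume "y \<in> f ` S"
      then obtain x where x: "x \<in> S" "y = f x" by auto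
      obtain k n where kn: "k \<in> span K" "\<And>w. w \<in> span K \<Longrightarrow> orthogonal n w" "x = k + n"
        using orthogonal_subspace_decomp_exists[of K x] by blast
      have k: "k \<in> K" using kn(1) K by (metis span_eq_iff)
      have "n \<in> S" using subspace_diff[OF S x(1), of k] k kn(3) by (auto simp: K_def)
      then have "n \<in> N"
        using kn(2) by (auto simp: N_def orthogonal_commute span_base)
      moreover have "f n = y" using k kn(3) x(2) by (simp add: K_def f.add)
      ultimately show "y \<in> f ` N" by auto
    qed
  qed
  moreover have "inj_on f (span N)"
  proof -
    have "x = 0" if "x \<in> N" "f x = 0" for x
    proof -
      have "x \<in> K" using that by (auto simp: N_def K_def)
      then show ?thesis using that(1) by (auto simp: N_def orthogonal_self)
    qed
    then show ?thesis
      using linear_inj_on_iff_eq_0[OF f N] N by (metis span_eq_iff)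
  qed
  then have "dim (f ` N) = dim N" by (rule dim_image_eq[OF f])
  ultimately show ?thesis by (simp add: K_def)
qed

text \<open>
  Linear independence is an open condition: if vectors \<open>v c x\<close> tend to the members \<open>c\<close> of an
  independent set, then eventually they span a space of at least the same dimension.
\<close>
lemma eventually_card_le_dim:
  fixes C :: "'y::euclidean_space set"
  assumes C: "independent C" and v: "\<And>c. c \<in> C \<Longrightarrow> (v c \<longlongrightarrow> c) F"
  shows "\<forall>\<^sub>F x in F. \<forall>W. subspace W \<longrightarrow> (\<forall>c\<in>C. v c x \<in> W) \<longrightarrow> card C \<le> dim W"
proof -
  have finC: "finite C" using C by (rule independent_imp_finite)
  have "\<forall>c. \<exists>g. linear g \<and> (\<forall>d\<in>C. g d = (if d = c then 1 else 0::real))"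
  proof
    fix c
    show "\<exists>g. linear g \<and> (\<forall>d\<in>C. g d = (if d = c then 1 else 0::real))"
      using linear_independent_extend[OF C, of "\<lambda>d. if d = c then 1 else 0"] by metis
  qed
  then obtain \<phi> where lin: "\<And>c. linear (\<phi> c)"
    and \<phi>: "\<And>c d. d \<in> C \<Longrightarrow> \<phi> c d = (if d = c then 1 else 0::real)"
    by metis
  have linsc: "linear (\<lambda>w. \<phi> c w *\<^sub>R d)" for c and d :: 'y
    using lin[of c] by (auto simp: linear_iff scaleR_left_distrib)
  have "\<exists>B. \<forall>w. \<bar>\<phi> c w\<bar> \<le> B * norm w" for c
    using linear_bounded[OF lin[of c]] by auto
  then obtain B where B: "\<And>c w. \<bar>\<phi> c w\<bar> \<le> B c * norm w" by metis
  have "((\<lambda>x. \<Sum>c\<in>C. B c * norm (v c x - c)) \<longlongrightarrow> (\<Sum>c\<in>C. B c * norm (c - c))) F"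
    by (intro tendsto_intros v)
  then have "\<forall>\<^sub>F x in F. (\<Sum>c\<in>C. B c * norm (v c x - c)) < 1"
    by (intro order_tendstoD(2)) auto
  then show ?thesis
  proof (rule eventually_mono, intro allI impI)
    fix x W assume x: "(\<Sum>c\<in>C. B c * norm (v c x - c)) < 1"
      and W: "subspace W" and vW: "\<forall>c\<in>C. v c x \<in> W"
    define L where "L w = (\<Sum>c\<in>C. \<phi> c w *\<^sub>R v c x)" for w
    have L: "linear L"
      unfolding L_def
      by (intro linear_compose_sum ballI linsc)
    have id: "(\<Sum>c\<in>C. \<phi> c w *\<^sub>R c) = w" if "w \<in> span C" for w
    proof -
      have l: "linear (\<lambda>w. \<Sum>c\<in>C. \<phi> c w *\<^sub>R c)"
        by (intro linear_compose_sum ballI linsc)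
      have e: "(\<Sum>c\<in>C. \<phi> c d *\<^sub>R c) = d" if "d \<in> C" for d
      proof -
        have "(\<Sum>c\<in>C. \<phi> c d *\<^sub>R c) = (\<Sum>c\<in>C. if c = d then c else 0)"
          using that by (intro sum.cong) (auto simp: \<phi>)
        then show ?thesis using that finC by simp
      qed
      show ?thesis by (rule linear_eq_on[OF l linear_ident \<open>w \<in> span C\<close>]) (rule e)
    qed
    \<comment> \<open>\<open>L\<close> is closer to the identity on \<open>span C\<close> than 1 in operator norm, hence injective there.\<close>
    have "w = 0" if w: "w \<in> span C" "L w = 0" for w
    proof (rule ccontr)
      assume "w \<noteq> 0"
      have "norm w = norm (L w - (\<Sum>c\<in>C. \<phi> c w *\<^sub>R c))" using w id by simp
      also have "\<dots> = norm (\<Sum>c\<in>C. \<phi> c w *\<^sub>R (v c x - c))"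
        by (simp add: L_def sum_subtractf scaleR_diff_right)
      also have "\<dots> \<le> (\<Sum>c\<in>C. (B c * norm w) * norm (v c x - c))"
        by (rule sum_norm_le) (use B in \<open>simp add: mult_right_mono\<close>)
      also have "\<dots> = norm w * (\<Sum>c\<in>C. B c * norm (v c x - c))"
        by (simp add: sum_distrib_left mult_ac)
      also have "\<dots> < norm w * 1" using x \<open>w \<noteq> 0\<close> by (intro mult_strict_left_mono) auto
      finally show False by simp
    qed
    then have "inj_on L (span C)"
      using linear_inj_on_iff_eq_0[OF L subspace_span] by blast
    then have "dim (L ` C) = dim C" by (rule dim_image_eq[OF L])
    moreover have "L ` C \<subseteq> W"
      using vW W by (auto simp: L_def intro!: subspace_sum subspace_scale)
    ultimately show "card C \<le> dim W"
      using C dim_subset[of "L ` C" W] by (simp add: dim_eq_card_independent)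
  qed
qed

text \<open>The rank of \<open>\<beta> x\<close> on a subspace is lower semicontinuous in \<open>x\<close>.\<close>
lemma eventually_rank_le:
  fixes \<beta> :: "'x::euclidean_space \<Rightarrow> 'x \<Rightarrow> 'y::euclidean_space"
  assumes \<beta>: "bounded_bilinear \<beta>" and P: "subspace P"
  shows "\<forall>\<^sub>F x in nhds p. dim (\<beta> p ` P) \<le> dim (\<beta> x ` P)"
proof -
  interpret bounded_bilinear \<beta> by (fact \<beta>)
  obtain C where C: "C \<subseteq> \<beta> p ` P" "independent C" "card C = dim (\<beta> p ` P)"
    using basis_exists[of "\<beta> p ` P"] by metis
  then have "\<forall>c\<in>C. \<exists>w\<in>P. \<beta> p w = c" by auto
  then obtain w where w: "\<And>c. c \<in> C \<Longrightarrow> w c \<in> P \<and> \<beta> p (w c) = c" by metis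
  have "((\<lambda>x. \<beta> x (w c)) \<longlongrightarrow> c) (nhds p)" if "c \<in> C" for c
  proof -
    have "((\<lambda>x. \<beta> x (w c)) \<longlongrightarrow> \<beta> p (w c)) (nhds p)"
      by (intro tendsto tendsto_intros filterlim_ident)
    then show ?thesis using w[OF that] by simp
  qed
  from eventually_card_le_dim[OF C(2) this]
  show ?thesis
  proof (rule eventually_mono)
    fix x assume *: "\<forall>W. subspace W \<longrightarrow> (\<forall>c\<in>C. \<beta> x (w c) \<in> W) \<longrightarrow> card C \<le> dim W"
    have "subspace (\<beta> x ` P)"
      by (intro linear_subspace_image P bounded_linear.linear bounded_linear_right)
    with * w C(3) show "dim (\<beta> p ` P) \<le> dim (\<beta> x ` P)" by force
  qed
qed

lemma orthogonal_projection_exists: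
  fixes W :: "'a::euclidean_space set"
  assumes W: "subspace W"
  obtains \<pi> where "linear \<pi>" "\<And>v. \<pi> v \<in> W" "\<And>w. w \<in> W \<Longrightarrow> \<pi> w = w"
    "\<And>v w. w \<in> W \<Longrightarrow> (v - \<pi> v) \<bullet> w = 0"
proof -
  have "\<forall>v. \<exists>y. y \<in> W \<and> (\<forall>w\<in>W. (v - y) \<bullet> w = 0)"
  proof
    fix v
    obtain y z where "y \<in> span W" "\<And>w. w \<in> span W \<Longrightarrow> orthogonal z w" "v = y + z"
      using orthogonal_subspace_decomp_exists[of W v] by blast
    then show "\<exists>y. y \<in> W \<and> (\<forall>w\<in>W. (v - y) \<bullet> w = 0)"
      using W by (metis add_diff_cancel_left' orthogonal_def span_eq_iff)
  qed
  then obtain \<pi> where \<pi>: "\<And>v. \<pi> v \<in> W" "\<And>v w. w \<in> W \<Longrightarrow> (v - \<pi> v) \<bullet> w = 0"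
    by metis
  have uniq: "\<pi> v = y" if "y \<in> W" "\<And>w. w \<in> W \<Longrightarrow> (v - y) \<bullet> w = 0" for v y
  proof -
    have "y - \<pi> v \<in> W" using that \<pi> W by (simp add: subspace_diff)
    then have "(v - \<pi> v) \<bullet> (y - \<pi> v) - (v - y) \<bullet> (y - \<pi> v) = 0" using that \<pi> by simp
    then have "(y - \<pi> v) \<bullet> (y - \<pi> v) = 0" by (simp add: inner_diff_left)
    then show ?thesis by simp
  qed
  show ?thesis
  proof
    show "linear \<pi>"
    proof
      fix a b :: 'a and r :: real
      show "\<pi> (a + b) = \<pi> a + \<pi> b"
        using \<pi>(2)[of _ a] \<pi>(2)[of _ b]
        by (intro uniq) (auto simp: \<pi> W subspace_add inner_diff_left inner_add_left)
      show "\<pi> (r *\<^sub>R a) = r *\<^sub>R \<pi> a"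
        using \<pi>(2)[of _ a]
        by (intro uniq) (auto simp: \<pi> W subspace_scale inner_diff_left)
    qed
    show "\<pi> w = w" if "w \<in> W" for w using that by (intro uniq) auto
  qed (use \<pi> in auto)
qed

section \<open>Analytic solutions of quadratic equations\<close>

lemma bilinear_Cauchy_product_sums:
  fixes \<gamma> :: "'x::euclidean_space \<Rightarrow> 'y::euclidean_space \<Rightarrow> 'z::real_normed_vector"
  assumes \<gamma>: "bounded_bilinear \<gamma>"
    and a: "summable (\<lambda>k. norm (a k))" and b: "summable (\<lambda>k. norm (b k))"
  shows "(\<lambda>k. \<Sum>i\<le>k. \<gamma> (a i) (b (k - i))) sums \<gamma> (\<Sum>k. a k) (\<Sum>k. b k)"
proof -
  interpret bounded_bilinear \<gamma> by (fact \<gamma>)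
  have expand: "\<gamma> x y = (\<Sum>e\<in>Basis. \<Sum>f\<in>Basis. ((x \<bullet> e) * (y \<bullet> f)) *\<^sub>R \<gamma> e f)" for x y
  proof -
    have "\<gamma> x y = \<gamma> (\<Sum>e\<in>Basis. (x \<bullet> e) *\<^sub>R e) (\<Sum>f\<in>Basis. (y \<bullet> f) *\<^sub>R f)"
      by (simp add: euclidean_representation)
    also have "\<dots> = (\<Sum>e\<in>Basis. \<Sum>f\<in>Basis. ((x \<bullet> e) * (y \<bullet> f)) *\<^sub>R \<gamma> e f)"
      by (subst sum_left)
        (simp only: sum_right scaleR_left scaleR_right scaleR_scaleR scaleR_sum_right mult.commute)
    finally show ?thesis .
  qed
  have coord: "(\<lambda>k. \<Sum>i\<le>k. (a i \<bullet> e) * (b (k - i) \<bullet> f)) sums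
      (((\<Sum>k. a k) \<bullet> e) * ((\<Sum>k. b k) \<bullet> f))" if "e \<in> Basis" "f \<in> Basis" for e f
  proof -
    have "summable (\<lambda>k. norm (a k \<bullet> e))"
      using that by (intro summable_comparison_test'[OF a]) (auto simp: Basis_le_norm)
    moreover have "summable (\<lambda>k. norm (b k \<bullet> f))"
      using that by (intro summable_comparison_test'[OF b]) (auto simp: Basis_le_norm)
    ultimately have "(\<lambda>k. \<Sum>i\<le>k. (a i \<bullet> e) * (b (k - i) \<bullet> f)) sums
        ((\<Sum>k. a k \<bullet> e) * (\<Sum>k. b k \<bullet> f))"
      by (rule Cauchy_product_sums)
    moreover have "(\<Sum>k. a k \<bullet> e) = (\<Sum>k. a k) \<bullet> e"
      using bounded_linear.suminf[OF bounded_linear_inner_left summable_norm_cancel[OF a]] by simp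
    moreover have "(\<Sum>k. b k \<bullet> f) = (\<Sum>k. b k) \<bullet> f"
      using bounded_linear.suminf[OF bounded_linear_inner_left summable_norm_cancel[OF b]] by simp
    ultimately show ?thesis by simp
  qed
  have "(\<lambda>k. \<Sum>e\<in>Basis. \<Sum>f\<in>Basis. (\<Sum>i\<le>k. (a i \<bullet> e) * (b (k - i) \<bullet> f)) *\<^sub>R \<gamma> e f) sums
      (\<Sum>e\<in>Basis. \<Sum>f\<in>Basis. (((\<Sum>k. a k) \<bullet> e) * ((\<Sum>k. b k) \<bullet> f)) *\<^sub>R \<gamma> e f)"
    by (intro sums_sum bounded_linear.sums[OF bounded_linear_scaleR_left] coord)
  also have "(\<lambda>k. \<Sum>e\<in>Basis. \<Sum>f\<in>Basis. (\<Sum>i\<le>k. (a i \<bullet> e) * (b (k - i) \<bullet> f)) *\<^sub>R \<gamma> e f) =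
      (\<lambda>k. \<Sum>i\<le>k. \<gamma> (a i) (b (k - i)))"
  proof
    fix k
    have "(\<Sum>i\<le>k. \<gamma> (a i) (b (k - i))) =
        (\<Sum>i\<le>k. \<Sum>e\<in>Basis. \<Sum>f\<in>Basis. ((a i \<bullet> e) * (b (k - i) \<bullet> f)) *\<^sub>R \<gamma> e f)"
      by (intro sum.cong refl expand)
    also have "\<dots> = (\<Sum>e\<in>Basis. \<Sum>i\<le>k. \<Sum>f\<in>Basis. ((a i \<bullet> e) * (b (k - i) \<bullet> f)) *\<^sub>R \<gamma> e f)"
      by (rule sum.swap)
    also have "\<dots> = (\<Sum>e\<in>Basis. \<Sum>f\<in>Basis. \<Sum>i\<le>k. ((a i \<bullet> e) * (b (k - i) \<bullet> f)) *\<^sub>R \<gamma> e f)"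
      by (intro sum.cong refl sum.swap)
    finally show "(\<Sum>e\<in>Basis. \<Sum>f\<in>Basis. (\<Sum>i\<le>k. (a i \<bullet> e) * (b (k - i) \<bullet> f)) *\<^sub>R \<gamma> e f) =
        (\<Sum>i\<le>k. \<gamma> (a i) (b (k - i)))"
      by (simp add: scaleR_sum_left)
  qed
  also note expand[symmetric]
  finally show ?thesis .
qed

text \<open>
  The coefficients of the formal power series solution \<open>h\<close> of \<open>h(t) = t u + \<gamma>(h(t), h(t))\<close>,
  obtained by comparing the coefficients of \<open>t\<^sup>k\<close>.
\<close>
fun fixed_point_coeff :: "('x \<Rightarrow> 'x \<Rightarrow> 'x) \<Rightarrow> 'x \<Rightarrow> nat \<Rightarrow> 'x::real_vector" where
  "fixed_point_coeff \<gamma> u k =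
     (if k = 0 then 0 else if k = 1 then u
      else \<Sum>i\<in>{1..<k}. \<gamma> (fixed_point_coeff \<gamma> u i) (fixed_point_coeff \<gamma> u (k - i)))"

declare fixed_point_coeff.simps [simp del]

lemma fixed_point_coeff_0 [simp]: "fixed_point_coeff \<gamma> u 0 = 0"
  by (simp add: fixed_point_coeff.simps)

lemma fixed_point_coeff_1 [simp]: "fixed_point_coeff \<gamma> u (Suc 0) = u"
  by (simp add: fixed_point_coeff.simps)

lemma fixed_point_coeff_in:
  assumes "subspace P" "u \<in> P" "\<And>x y. x \<in> P \<Longrightarrow> y \<in> P \<Longrightarrow> \<gamma> x y \<in> P"
  shows "fixed_point_coeff \<gamma> u k \<in> P"
proof (induction k rule: less_induct)
  case (less k)
  have "(\<Sum>i\<in>{1..<k}. \<gamma> (fixed_point_coeff \<gamma> u i) (fixed_point_coeff \<gamma> u (k - i))) \<in> P"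
    by (intro subspace_sum assms(1,3) less.IH) auto
  then show ?case
    using assms(1,2) by (subst fixed_point_coeff.simps) (simp add: subspace_0)
qed

text \<open>
  The partial sums \<open>s\<^sub>n\<close> of the norms of the terms satisfy \<open>s\<^sub>n\<^sub>+\<^sub>1 \<le> \<rho> + K s\<^sub>n\<^sup>2\<close> with \<open>\<rho> = \<parallel>u\<parallel> r\<close>, and
  \<open>s \<mapsto> \<rho> + K s\<^sup>2\<close> maps \<open>[0, 2\<rho>]\<close> to itself if \<open>4 K \<rho> \<le> 1\<close>.
\<close>
lemma fixed_point_coeff_bound:
  fixes \<gamma> :: "'x::real_normed_vector \<Rightarrow> 'x \<Rightarrow> 'x"
  assumes \<gamma>: "\<And>x y. norm (\<gamma> x y) \<le> norm x * norm y * K" and K: "K \<ge> 0"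
    and r: "r \<ge> 0" "4 * K * (norm u * r) \<le> 1"
  shows "(\<Sum>k\<le>n. norm (fixed_point_coeff \<gamma> u k) * r ^ k) \<le> 2 * (norm u * r)"
proof (induction n)
  case 0
  show ?case using r by simp
next
  case (Suc n)
  define c where "c = fixed_point_coeff \<gamma> u"
  define a where "a k = norm (c k) * r ^ k" for k
  define \<rho> where "\<rho> = norm u * r"
  have a0: "a k \<ge> 0" for k using r by (simp add: a_def)
  have \<rho>: "\<rho> \<ge> 0" "4 * K * \<rho> \<le> 1" using r by (auto simp: \<rho>_def)
  have IH: "(\<Sum>k\<le>n. a k) \<le> 2 * \<rho>" using Suc by (simp add: a_def c_def \<rho>_def)
  have term_le: "a k \<le> (if k = 1 then \<rho> else 0) + (\<Sum>i\<in>{1..<k}. K * (a i * a (k - i)))" for k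
  proof (cases "k = 0 \<or> k = 1")
    case True
    then show ?thesis by (auto simp: a_def c_def \<rho>_def)
  next
    case False
    have "a k = norm (\<Sum>i\<in>{1..<k}. \<gamma> (c i) (c (k - i))) * r ^ k"
      using False unfolding a_def c_def by (subst fixed_point_coeff.simps) simp
    also have "\<dots> \<le> (\<Sum>i\<in>{1..<k}. norm (c i) * norm (c (k - i)) * K) * r ^ k"
      by (intro mult_right_mono sum_norm_le \<gamma>) (use r in auto)
    also have "\<dots> = (\<Sum>i\<in>{1..<k}. K * (a i * a (k - i)))"
    proof -
      have "r ^ k = r ^ i * r ^ (k - i)" if "i \<in> {1..<k}" for i
        using that by (simp add: power_add[symmetric])
      then show ?thesis
        unfolding sum_distrib_right a_def by (intro sum.cong) (auto simp: mult_ac)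
    qed
    finally show ?thesis using False by simp
  qed
  define Z where "Z = Sigma {..Suc n} (\<lambda>k. {1..<k})"
  have "(\<Sum>k\<le>Suc n. a k) \<le>
      (\<Sum>k\<le>Suc n. (if k = 1 then \<rho> else 0) + (\<Sum>i\<in>{1..<k}. K * (a i * a (k - i))))"
    by (intro sum_mono term_le)
  also have "\<dots> = \<rho> + K * (\<Sum>k\<le>Suc n. \<Sum>i\<in>{1..<k}. a i * a (k - i))"
    by (simp add: sum.distrib sum_distrib_left del: sum.atMost_Suc)
  also have "(\<Sum>k\<le>Suc n. \<Sum>i\<in>{1..<k}. a i * a (k - i)) = (\<Sum>(k, i)\<in>Z. a i * a (k - i))"
    unfolding Z_def by (subst sum.Sigma) auto
  also have "\<dots> = (\<Sum>(i, j)\<in>(\<lambda>(k, i). (i, k - i)) ` Z. a i * a j)"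
    by (subst sum.reindex) (auto simp: inj_on_def Z_def intro!: sum.cong)
  also have "\<dots> \<le> (\<Sum>(i, j)\<in>{..n} \<times> {..n}. a i * a j)"
    by (rule sum_mono2) (auto simp: Z_def a0)
  also have "\<dots> = (\<Sum>i\<le>n. a i) * (\<Sum>j\<le>n. a j)"
    by (simp add: sum.cartesian_product[symmetric] sum_product)
  also have "\<dots> \<le> (2 * \<rho>) * (2 * \<rho>)"
    by (intro mult_mono IH) (auto simp: a0 sum_nonneg \<rho>)
  also have "\<rho> + K * ((2 * \<rho>) * (2 * \<rho>)) = \<rho> + (4 * K * \<rho>) * \<rho>" by simp
  also have "\<dots> \<le> \<rho> + 1 * \<rho>" using \<rho> by (intro add_left_mono mult_right_mono)
  finally have "(\<Sum>k\<le>Suc n. a k) \<le> 2 * \<rho>" using K by (simp add: mult_left_mono)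
  then show ?case by (simp add: a_def c_def \<rho>_def)
qed

text \<open>
  The analytic implicit function theorem in the only case needed here: a quadratic equation.  The
  bound on \<open>h t\<close> gives \<open>h(t) = t u + O(t\<^sup>2)\<close>.
\<close>
lemma quadratic_fixed_point_series:
  fixes \<gamma> :: "'x::euclidean_space \<Rightarrow> 'x \<Rightarrow> 'x"
  assumes \<gamma>: "bounded_bilinear \<gamma>" and P: "subspace P" "u \<in> P"
    and \<gamma>P: "\<And>x y. x \<in> P \<Longrightarrow> y \<in> P \<Longrightarrow> \<gamma> x y \<in> P"
  obtains R c h where "R > 0" "c 0 = 0"
    "\<And>t. \<bar>t\<bar> < R \<Longrightarrow> summable (\<lambda>k. norm (t ^ k *\<^sub>R c k))"
    "\<And>t. \<bar>t\<bar> < R \<Longrightarrow> (\<lambda>k. t ^ k *\<^sub>R c k) sums h t"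
    "\<And>t. \<bar>t\<bar> < R \<Longrightarrow> h t = t *\<^sub>R u + \<gamma> (h t) (h t)"
    "\<And>t. \<bar>t\<bar> < R \<Longrightarrow> norm (h t) \<le> 2 * norm u * \<bar>t\<bar>"
    "\<And>t. \<bar>t\<bar> < R \<Longrightarrow> h t \<in> P"
proof -
  interpret bounded_bilinear \<gamma> by (fact \<gamma>)
  obtain K where K: "K > 0" "\<And>x y. norm (\<gamma> x y) \<le> norm x * norm y * K"
    using pos_bounded by blast
  define c where "c = fixed_point_coeff \<gamma> u"
  define R where "R = 1 / (4 * K * (norm u + 1))"
  have den: "4 * K * (norm u + 1) > 0" using K by (simp add: add_nonneg_pos)
  then have R: "R > 0" by (simp add: R_def)
  have small: "4 * K * (norm u * \<bar>t\<bar>) \<le> 1" if "\<bar>t\<bar> < R" for t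
  proof -
    have "4 * K * (norm u * \<bar>t\<bar>) \<le> (4 * K * (norm u + 1)) * \<bar>t\<bar>"
      using K by (simp add: algebra_simps)
    also have "\<dots> \<le> (4 * K * (norm u + 1)) * R" using that den by (intro mult_left_mono) auto
    also have "\<dots> = 1" using den unfolding R_def by (metis less_irrefl nonzero_mult_div_cancel_left times_divide_eq_right)
    finally show ?thesis .
  qed
  have bound: "(\<Sum>k\<le>n. norm (t ^ k *\<^sub>R c k)) \<le> 2 * norm u * \<bar>t\<bar>" if "\<bar>t\<bar> < R" for t n
    using fixed_point_coeff_bound[OF K(2) less_imp_le[OF K(1)] abs_ge_zero small[OF that], of n]
    by (simp add: c_def power_abs mult_ac)
  have summ: "summable (\<lambda>k. norm (t ^ k *\<^sub>R c k))" if "\<bar>t\<bar> < R" for t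
    by (rule bounded_imp_summable[OF _ bound[OF that]]) auto
  define h where "h t = (\<Sum>k. t ^ k *\<^sub>R c k)" for t
  have sums: "(\<lambda>k. t ^ k *\<^sub>R c k) sums h t" if "\<bar>t\<bar> < R" for t
    unfolding h_def by (rule summable_sums[OF summable_norm_cancel[OF summ[OF that]]])
  have "h t = t *\<^sub>R u + \<gamma> (h t) (h t)" if t: "\<bar>t\<bar> < R" for t
  proof -
    have "(\<lambda>k. (if k = 1 then t *\<^sub>R u else 0) +
        (\<Sum>i\<le>k. \<gamma> (t ^ i *\<^sub>R c i) (t ^ (k - i) *\<^sub>R c (k - i)))) sums (t *\<^sub>R u + \<gamma> (h t) (h t))"
      unfolding h_def
      by (intro sums_add bilinear_Cauchy_product_sums[OF \<gamma> summ[OF t] summ[OF t]] sums_single)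
    also have "(\<lambda>k. (if k = 1 then t *\<^sub>R u else 0) +
        (\<Sum>i\<le>k. \<gamma> (t ^ i *\<^sub>R c i) (t ^ (k - i) *\<^sub>R c (k - i)))) = (\<lambda>k. t ^ k *\<^sub>R c k)"
    proof
      fix k
      have "(\<Sum>i\<le>k. \<gamma> (t ^ i *\<^sub>R c i) (t ^ (k - i) *\<^sub>R c (k - i))) =
          t ^ k *\<^sub>R (\<Sum>i\<le>k. \<gamma> (c i) (c (k - i)))"
        unfolding scaleR_sum_right
        by (intro sum.cong) (auto simp: scaleR_left scaleR_right power_add[symmetric])
      also have "(\<Sum>i\<le>k. \<gamma> (c i) (c (k - i))) = (\<Sum>i\<in>{1..<k}. \<gamma> (c i) (c (k - i)))"
      proof (rule sum.mono_neutral_right)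
        show "\<forall>i\<in>{..k} - {1..<k}. \<gamma> (c i) (c (k - i)) = 0"
        proof
          fix i assume "i \<in> {..k} - {1..<k}"
          then have "i = 0 \<or> i = k" by auto
          then show "\<gamma> (c i) (c (k - i)) = 0" by (auto simp: c_def zero_left zero_right)
        qed
      qed auto
      also have "\<dots> = (if k = 1 then 0 else c k)"
      proof (cases "k = 0 \<or> k = 1")
        case False
        then show ?thesis unfolding c_def by (simp add: fixed_point_coeff.simps[of \<gamma> u k])
      qed (auto simp: c_def)
      finally show "(if k = 1 then t *\<^sub>R u else 0) +
          (\<Sum>i\<le>k. \<gamma> (t ^ i *\<^sub>R c i) (t ^ (k - i) *\<^sub>R c (k - i))) = t ^ k *\<^sub>R c k"
        by (auto simp: c_def)
    qed
    finally show ?thesis using sums[OF t] by (simp add: sums_unique2)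
  qed
  moreover have "norm (h t) \<le> 2 * norm u * \<bar>t\<bar>" if t: "\<bar>t\<bar> < R" for t
  proof -
    have "norm (h t) \<le> (\<Sum>k. norm (t ^ k *\<^sub>R c k))"
      unfolding h_def by (rule summable_norm[OF summ[OF t]])
    also have "\<dots> \<le> 2 * norm u * \<bar>t\<bar>"
    proof (rule suminf_le_const[OF summ[OF t]])
      fix n
      have "(\<Sum>k<n. norm (t ^ k *\<^sub>R c k)) \<le> (\<Sum>k\<le>n. norm (t ^ k *\<^sub>R c k))"
        by (rule sum_mono2) auto
      then show "(\<Sum>k<n. norm (t ^ k *\<^sub>R c k)) \<le> 2 * norm u * \<bar>t\<bar>"
        using bound[OF t, of n] by linarith
    qed
    finally show ?thesis .
  qed
  moreover have "h t \<in> P" if t: "\<bar>t\<bar> < R" for t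
  proof (rule closed_sequentially[OF closed_subspace[OF P(1)]])
    show "(\<Sum>k<n. t ^ k *\<^sub>R c k) \<in> P" for n
      unfolding c_def by (intro subspace_sum subspace_scale fixed_point_coeff_in P \<gamma>P)
    show "(\<lambda>n. \<Sum>k<n. t ^ k *\<^sub>R c k) \<longlonglongrightarrow> h t" using sums[OF t] by (simp add: sums_def)
  qed
  ultimately show thesis using that[of R c h] R summ sums by (simp add: c_def)
qed

text \<open>
  A convergent power series is analytic in every point of its interval of convergence.  Each
  coordinate extends to a holomorphic function on a disc, whose Taylor series around a real point
  has the required real parts.
\<close>
lemma power_series_real_analytic_on:
  fixes c :: "nat \<Rightarrow> 'x::euclidean_space"
  assumes y: "\<And>t. \<bar>t\<bar> < R \<Longrightarrow> (\<lambda>k. t ^ k *\<^sub>R c k) sums y t"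
    and A: "\<And>a. a \<in> A \<Longrightarrow> \<bar>a\<bar> < R"
  shows "real_analytic_on y A"
  unfolding real_analytic_on_def
proof
  fix a assume "a \<in> A"
  then have a: "\<bar>a\<bar> < R" by (rule A)
  define f where "f e z = (\<Sum>k. complex_of_real (c k \<bullet> e) * z ^ k)" for e z
  have real: "(\<lambda>k. (c k \<bullet> e) * t ^ k) sums (y t \<bullet> e)" if "\<bar>t\<bar> < R" for t e
    using bounded_linear.sums[OF bounded_linear_inner_left y[OF that], of e]
    by (simp add: mult.commute)
  have f: "(\<lambda>k. complex_of_real (c k \<bullet> e) * z ^ k) sums f e z" if "cmod z < R" for e z
  proof -
    obtain s where s: "cmod z < s" "s < R" using dense[of "cmod z" R] \<open>cmod z < R\<close> by blast
    then have "\<bar>s\<bar> < R" using norm_ge_zero[of z] by linarith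
    then have "summable (\<lambda>k. (c k \<bullet> e) * s ^ k)" by (intro sums_summable[OF real])
    then have "summable (\<lambda>k. complex_of_real (c k \<bullet> e) * complex_of_real s ^ k)"
      using summable_of_real[of "\<lambda>k. (c k \<bullet> e) * s ^ k"] by simp
    then have "summable (\<lambda>k. complex_of_real (c k \<bullet> e) * z ^ k)"
      by (rule powser_inside) (use s norm_ge_zero[of z] in auto)
    then show ?thesis unfolding f_def by (rule summable_sums)
  qed
  have f_real: "f e (of_real t) = of_real (y t \<bullet> e)" if "\<bar>t\<bar> < R" for t e
  proof -
    have "(\<lambda>k. complex_of_real (c k \<bullet> e) * of_real t ^ k) sums of_real (y t \<bullet> e)"
      using sums_of_real[OF real[OF that], where ?'a = complex] by simp
    then show ?thesis using f[of "of_real t" e] that by (simp add: sums_unique2)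
  qed
  have hol: "f e holomorphic_on ball 0 R" for e
    by (rule power_series_holomorphic[of 0 R "\<lambda>k. of_real (c k \<bullet> e)"]) (use f in simp)
  define d where "d n = (\<Sum>e\<in>Basis. Re ((deriv ^^ n) (f e) (of_real a) / fact n) *\<^sub>R e)" for n
  show "\<exists>r>0. \<exists>d. \<forall>t\<in>A. \<bar>t - a\<bar> < r \<longrightarrow> (\<lambda>k. (t - a) ^ k *\<^sub>R d k) sums y t"
  proof (rule exI[of _ "R - \<bar>a\<bar>"], intro conjI exI[of _ d] ballI impI)
    show "0 < R - \<bar>a\<bar>" using a by simp
    fix t assume t: "\<bar>t - a\<bar> < R - \<bar>a\<bar>"
    then have tR: "\<bar>t\<bar> < R" by linarith
    have coord: "(\<lambda>n. (t - a) ^ n * Re ((deriv ^^ n) (f e) (of_real a) / fact n)) sums (y t \<bullet> e)"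
      for e
    proof -
      have "ball (complex_of_real a) (R - \<bar>a\<bar>) \<subseteq> ball 0 R"
        by (intro ball_subset_ball_iff[THEN iffD2]) simp
      then have "f e holomorphic_on ball (of_real a) (R - \<bar>a\<bar>)"
        using hol holomorphic_on_subset by blast
      moreover have "complex_of_real t \<in> ball (of_real a) (R - \<bar>a\<bar>)"
        using t by (simp add: dist_norm norm_minus_commute flip: of_real_diff)
      ultimately have s: "(\<lambda>n. (deriv ^^ n) (f e) (of_real a) / fact n * (of_real t - of_real a) ^ n)
          sums f e (of_real t)"
        by (rule holomorphic_power_series)
      have Re: "Re (z * (complex_of_real t - of_real a) ^ n) = (t - a) ^ n * Re z" for z n
        by (simp flip: of_real_diff of_real_power)
      show ?thesis
        using sums_Re[OF s] by (simp only: Re f_real[OF tR] Re_complex_of_real)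
    qed
    have "(\<lambda>n. \<Sum>e\<in>Basis. ((t - a) ^ n * Re ((deriv ^^ n) (f e) (of_real a) / fact n)) *\<^sub>R e)
        sums (\<Sum>e\<in>Basis. (y t \<bullet> e) *\<^sub>R e)"
      by (intro sums_sum bounded_linear.sums[OF bounded_linear_scaleR_left] coord)
    then show "(\<lambda>k. (t - a) ^ k *\<^sub>R d k) sums y t"
      by (simp add: d_def scaleR_sum_right euclidean_representation)
  qed
qed

section \<open>Edge form and infinitesimal motions\<close>

text \<open>
  The polarization of the quadratic map \<open>edge_function E\<close>, with the same convention of vanishing
  outside of \<open>E\<close>.  Thus \<open>2 *\<^sub>R edge_form E p u\<close> is the differential of the edge function at \<open>p\<close> in
  direction \<open>u\<close>, and \<open>edge_form E p\<close> is the rigidity matrix.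
\<close>
definition edge_form ::
    "'v::finite set set \<Rightarrow> 'a::euclidean_space ^ 'v \<Rightarrow> 'a ^ 'v \<Rightarrow> real ^ 'v set" where
  "edge_form E x y =
     (\<chi> e. if e \<in> E then THE l. \<exists>i j. e = {i, j} \<and> l = (x $ i - x $ j) \<bullet> (y $ i - y $ j) else 0)"

lemma edge_form_nth:
  "edge_form E x y $ {i, j} = (if {i, j} \<in> E then (x $ i - x $ j) \<bullet> (y $ i - y $ j) else 0)"
proof -
  have "(THE l. \<exists>k m. {i, j} = {k, m} \<and> l = (x $ k - x $ m) \<bullet> (y $ k - y $ m)) =
      (x $ i - x $ j) \<bullet> (y $ i - y $ j)"
    by (rule the_equality) (auto simp: doubleton_eq_iff inner_diff)
  then show ?thesis by (simp add: edge_form_def)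
qed

lemma edge_form_outside: "e \<notin> E \<Longrightarrow> edge_form E x y $ e = 0"
  by (simp add: edge_form_def)

lemma edge_form_commute: "edge_form E x y = edge_form E y x"
  by (simp add: edge_form_def vec_eq_iff inner_commute)

lemma edge_function_eq_edge_form: "edge_function E x = edge_form E x x"
  by (simp add: edge_function_def edge_form_def sq_length_def power2_norm_eq_inner vec_eq_iff)

lemma simple_graph_complete_graph: "simple_graph complete_graph"
  by (simp add: simple_graph_def complete_graph_def)

lemma edge_form_eqI:
  assumes "simple_graph E"
    and "\<And>i j. {i, j} \<in> E \<Longrightarrow> edge_form E x y $ {i, j} = z $ {i, j}"
    and "\<And>e. e \<notin> E \<Longrightarrow> z $ e = 0"
  shows "edge_form E x y = z"
proof (rule vec_eq_iff[THEN iffD2], rule allI)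
  fix e
  show "edge_form E x y $ e = z $ e"
  proof (cases "e \<in> E")
    case True
    then obtain i j where "e = {i, j}"
      using assms(1) by (auto simp: simple_graph_def card_2_iff)
    then show ?thesis using True assms(2) by simp
  qed (simp add: edge_form_outside assms(3))
qed

lemma bounded_bilinear_edge_form:
  assumes "simple_graph E"
  shows "bounded_bilinear (edge_form E :: 'a::euclidean_space ^ 'v::finite \<Rightarrow> _)"
proof -
  have add: "edge_form E x (y + z) = edge_form E x y + edge_form E x z"
    for x y z :: "'a ^ 'v"
    by (rule edge_form_eqI[OF assms])
      (auto simp: edge_form_nth edge_form_outside inner_diff inner_add)
  have scale: "edge_form E x (r *\<^sub>R y) = r *\<^sub>R edge_form E x y" for r and x y :: "'a ^ 'v"
    by (rule edge_form_eqI[OF assms])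
      (auto simp: edge_form_nth edge_form_outside simp flip: scaleR_diff_right)
  have "linear (edge_form E x)" for x :: "'a ^ 'v"
    by (intro linearI add scale)
  then have "bilinear (edge_form E :: 'a ^ 'v \<Rightarrow> _)"
    unfolding bilinear_def by (auto simp: edge_form_commute[of E _ "y :: 'a ^ 'v" for y])
  then show ?thesis by (simp add: bilinear_conv_bounded_bilinear)
qed

lemma edge_form_eq_0_iff:
  assumes "simple_graph E"
  shows "edge_form E x u = 0 \<longleftrightarrow> (\<forall>i j. {i, j} \<in> E \<longrightarrow> (x $ i - x $ j) \<bullet> (u $ i - u $ j) = 0)"
proof
  assume "edge_form E x u = 0"
  then show "\<forall>i j. {i, j} \<in> E \<longrightarrow> (x $ i - x $ j) \<bullet> (u $ i - u $ j) = 0"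
    by (metis edge_form_nth zero_index)
next
  assume "\<forall>i j. {i, j} \<in> E \<longrightarrow> (x $ i - x $ j) \<bullet> (u $ i - u $ j) = 0"
  then show "edge_form E x u = 0" by (intro edge_form_eqI assms) (auto simp: edge_form_nth)
qed

lemma edge_form_complete_eq_0_iff:
  fixes x u :: "'a::euclidean_space ^ 'v::finite"
  shows "edge_form complete_graph x u = 0 \<longleftrightarrow> (\<forall>i j. (x $ i - x $ j) \<bullet> (u $ i - u $ j) = 0)"
proof -
  have "{i, j} \<in> complete_graph \<longleftrightarrow> i \<noteq> j" for i j :: 'v
    by (auto simp: complete_graph_def)
  moreover have "(x $ i - x $ j) \<bullet> (u $ i - u $ j) = 0" if "i = j" for i j
    using that by simp
  ultimately show ?thesis
    unfolding edge_form_eq_0_iff[OF simple_graph_complete_graph] by blast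
qed

lemma edge_function_complete_eq_iff:
  "edge_function complete_graph x = edge_function complete_graph y \<longleftrightarrow>
     (\<forall>i j. norm (x $ i - x $ j) = norm (y $ i - y $ j))"
proof
  assume *: "edge_function complete_graph x = edge_function complete_graph y"
  show "\<forall>i j. norm (x $ i - x $ j) = norm (y $ i - y $ j)"
  proof (intro allI)
    fix i j
    show "norm (x $ i - x $ j) = norm (y $ i - y $ j)"
      using arg_cong[OF *, of "\<lambda>z. z $ {i, j}"]
      by (cases "i = j") (auto simp: edge_function_def complete_graph_def sq_length_edge)
  qed
next
  assume "\<forall>i j. norm (x $ i - x $ j) = norm (y $ i - y $ j)"
  then show "edge_function complete_graph x = edge_function complete_graph y"
    by (simp add: edge_function_def sq_length_def vec_eq_iff)
qed

text \<open>
  Since the edge function is quadratic, its increment between \<open>p\<close> and \<open>p + h\<close> is exactly its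
  differential at the midpoint applied to \<open>h\<close>.  Hence two configurations with equal edge lengths
  differ by an infinitesimal motion of their midpoint, which is used below instead of
  differentiating paths.
\<close>
lemma edge_function_add:
  fixes p h :: "'a::euclidean_space ^ 'v::finite"
  assumes "simple_graph E"
  shows "edge_function E (p + h) = edge_function E p + 2 *\<^sub>R edge_form E (p + (1/2) *\<^sub>R h) h"
proof -
  interpret bounded_bilinear "edge_form E :: 'a ^ 'v \<Rightarrow> _"
    by (rule bounded_bilinear_edge_form[OF assms])
  show ?thesis
    by (simp add: edge_function_eq_edge_form add_left add_right scaleR_left scaleR_right
        scaleR_add_right edge_form_commute[of E h p] scaleR_2)
qed

text \<open>The symmetric infinitesimal motions of a framework: the kernel of its restricted differential.\<close>
definition symmetric_inf_motions ::
    "'v::finite set set \<Rightarrow> ('a::euclidean_space \<Rightarrow> 'a) set \<Rightarrow> (('a \<Rightarrow> 'a) \<Rightarrow> 'v \<Rightarrow> 'v) \<Rightarrow>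
     'a ^ 'v \<Rightarrow> ('a ^ 'v) set" where
  "symmetric_inf_motions E S \<Phi> x = {u \<in> symmetric_configs S \<Phi>. edge_form E x u = 0}"

text \<open>
  The infinitesimal motions induced by symmetry-preserving Euclidean motions: the skew-symmetric
  map \<open>A\<close> commutes with \<open>S\<close> and the translation \<open>b\<close> is fixed by \<open>S\<close>.  Then \<open>x \<mapsto> A x + b\<close> yields a
  symmetric infinitesimal motion of every symmetric configuration, not only of \<open>p\<close>.
\<close>
definition trivial_inf_motion ::
    "('a::euclidean_space \<Rightarrow> 'a) set \<Rightarrow> 'a ^ 'v::finite \<Rightarrow> 'a ^ 'v \<Rightarrow> bool" where
  "trivial_inf_motion S p u \<longleftrightarrow>
     (\<exists>A b. linear A \<and> (\<forall>v w. A v \<bullet> w = - (v \<bullet> A w)) \<and> (\<forall>x\<in>S. \<forall>v. A (x v) = x (A v)) \<and>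
        (\<forall>x\<in>S. x b = b) \<and> (\<forall>i. u $ i = A (p $ i) + b))"

lemma subspace_symmetric_configs:
  assumes "\<And>x. x \<in> S \<Longrightarrow> linear x"
  shows "subspace (symmetric_configs S \<Phi>)"
  using assms unfolding subspace_def symmetric_configs_def
  by (auto simp: linear_0 linear_add linear_scale)

lemma subspace_symmetric_inf_motions:
  fixes S :: "('a::euclidean_space \<Rightarrow> 'a) set" and p :: "'a ^ 'v::finite"
  assumes "simple_graph E" and "\<And>x. x \<in> S \<Longrightarrow> linear x"
  shows "subspace (symmetric_inf_motions E S \<Phi> p)"
proof -
  interpret bounded_bilinear "edge_form E :: 'a ^ 'v \<Rightarrow> _"
    by (rule bounded_bilinear_edge_form[OF assms(1)])
  have "subspace (symmetric_configs S \<Phi>)" using assms(2) by (rule subspace_symmetric_configs)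
  then show ?thesis
    unfolding subspace_def symmetric_inf_motions_def
    by (auto simp: zero_right add_right scaleR_right)
qed

section \<open>Velocities of congruent paths\<close>

text \<open>
  The data \<open>a i \<mapsto> w i\<close> defines a linear map \<open>D\<close> on the span \<open>W\<close> of the vectors \<open>a i\<close>, which is
  skew-symmetric as a form on \<open>W\<close>.  With \<open>\<pi>\<close> the orthogonal projection onto \<open>W\<close> and \<open>C = D \<circ> \<pi>\<close>, the
  map \<open>C - C\<^sup>T + C\<^sup>T \<pi>\<close> is a skew-symmetric extension of \<open>D\<close> to the whole space.  Being
  defined canonically, it commutes with all symmetries, so that no averaging is needed.
\<close>
lemma skew_map_exists:
  fixes a w :: "'v::finite \<Rightarrow> 'a::euclidean_space"
  assumes skew: "\<And>i j. a i \<bullet> w j + w i \<bullet> a j = 0"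
    and dep: "\<And>c. (\<Sum>i\<in>UNIV. c i *\<^sub>R a i) = 0 \<Longrightarrow> (\<Sum>i\<in>UNIV. c i *\<^sub>R w i) = 0"
    and S: "\<And>x. x \<in> S \<Longrightarrow> orthogonal_transformation x"
    and \<phi>: "\<And>x. x \<in> S \<Longrightarrow> surj (\<phi> x)"
    and xa: "\<And>x i. x \<in> S \<Longrightarrow> x (a i) = a (\<phi> x i)"
    and xw: "\<And>x i. x \<in> S \<Longrightarrow> x (w i) = w (\<phi> x i)"
  obtains A where "linear A" "\<And>v w. A v \<bullet> w = - (v \<bullet> A w)"
    "\<And>x v. x \<in> S \<Longrightarrow> A (x v) = x (A v)" "\<And>i. A (a i) = w i"
proof -
  define T where "T c = (\<Sum>i\<in>UNIV. c $ i *\<^sub>R a i)" for c :: "real ^ 'v"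
  define U where "U c = (\<Sum>i\<in>UNIV. c $ i *\<^sub>R w i)" for c :: "real ^ 'v"
  have T: "linear T"
    unfolding T_def by (rule linearI)
      (auto simp: scaleR_add_left sum.distrib scaleR_sum_right)
  have U: "linear U"
    unfolding U_def by (rule linearI)
      (auto simp: scaleR_add_left sum.distrib scaleR_sum_right)
  obtain g where g: "linear g" "\<And>v. v \<in> range T \<Longrightarrow> T (g v) = v"
    using linear_exists_right_inverse_on[OF T subspace_UNIV] by auto
  define W where "W = range T"
  have W: "subspace W" unfolding W_def by (rule linear_subspace_image[OF T subspace_UNIV])
  obtain \<pi> where \<pi>: "linear \<pi>" "\<And>v. \<pi> v \<in> W" "\<And>w. w \<in> W \<Longrightarrow> \<pi> w = w"
    "\<And>v w. w \<in> W \<Longrightarrow> (v - \<pi> v) \<bullet> w = 0"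
    by (rule orthogonal_projection_exists[OF W]) blast
  define D where "D = U \<circ> g"
  have D: "linear D" unfolding D_def by (rule linear_compose[OF g(1) U])
  have DT: "D (T c) = U c" for c
  proof -
    have "T (g (T c) - c) = 0" using g(2)[of "T c"] by (simp add: linear_diff[OF T])
    then have "U (g (T c) - c) = 0" unfolding T_def U_def by (rule dep)
    then show ?thesis by (simp add: D_def linear_diff[OF U])
  qed
  have aW: "a i = T (axis i 1)" and wU: "w i = U (axis i 1)" for i
    by (simp_all add: T_def U_def axis_def if_distrib[of "\<lambda>r. r *\<^sub>R _"] cong: if_cong)
  have D_skew: "D v \<bullet> v' + v \<bullet> D v' = 0" if "v \<in> W" "v' \<in> W" for v v'
  proof -
    obtain c c' where c: "v = T c" "v' = T c'"
      using \<open>v \<in> W\<close> \<open>v' \<in> W\<close> by (auto simp: W_def)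
    have "D v \<bullet> v' + v \<bullet> D v' = U c \<bullet> T c' + T c \<bullet> U c'" by (simp add: c DT)
    also have "\<dots> = (\<Sum>j\<in>UNIV. \<Sum>i\<in>UNIV. c $ i * c' $ j * (a i \<bullet> w j + w i \<bullet> a j))"
      unfolding T_def U_def inner_sum_left inner_sum_right
      unfolding sum.distrib[symmetric]
      by (intro sum.cong refl) (simp add: distrib_left mult.assoc mult.left_commute)
    also have "\<dots> = 0" by (simp add: skew)
    finally show ?thesis .
  qed
  have xT: "x (T c) = (\<Sum>i\<in>UNIV. c $ i *\<^sub>R a (\<phi> x i))" if "x \<in> S" for x c
    using S[OF that] xa[OF that]
    by (simp add: T_def orthogonal_transformation_def linear_sum linear_scale)
  have xU: "x (U c) = (\<Sum>i\<in>UNIV. c $ i *\<^sub>R w (\<phi> x i))" if "x \<in> S" for x c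
    using S[OF that] xw[OF that]
    by (simp add: U_def orthogonal_transformation_def linear_sum linear_scale)
  have Da: "D (a i) = w i" for i by (simp only: aW DT wU)
  have aW': "a i \<in> W" for i by (simp add: W_def aW)
  have xW: "x v \<in> W" if "x \<in> S" "v \<in> W" for x v
  proof -
    obtain c where "v = T c" using \<open>v \<in> W\<close> by (auto simp: W_def)
    then show ?thesis using W aW' by (auto simp: xT[OF \<open>x \<in> S\<close>] intro!: subspace_sum subspace_scale)
  qed
  have D_comm: "D (x v) = x (D v)" if "x \<in> S" "v \<in> W" for x v
  proof -
    obtain c where "v = T c" using \<open>v \<in> W\<close> by (auto simp: W_def)
    then show ?thesis
      by (simp add: xT[OF \<open>x \<in> S\<close>] xU[OF \<open>x \<in> S\<close>] DT linear_sum[OF D] linear_scale[OF D] Da)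
  qed
  have \<pi>_comm: "\<pi> (x v) = x (\<pi> v)" if x: "x \<in> S" for x v
  proof -
    note ox = S[OF x, unfolded orthogonal_transformation_def]
    define d where "d = \<pi> (x v) - x (\<pi> v)"
    have d: "d \<in> W" unfolding d_def by (rule subspace_diff[OF W \<pi>(2) xW[OF x \<pi>(2)]])
    then obtain c where c: "d = T c" by (auto simp: W_def)
    have "x (v - \<pi> v) \<bullet> a i = 0" for i
    proof -
      obtain j where "i = \<phi> x j" using \<phi>[OF x] by (metis surjD)
      then have "a i = x (a j)" using xa[OF x] by simp
      then show ?thesis using ox \<pi>(4)[OF aW'] by simp
    qed
    then have "x (v - \<pi> v) \<bullet> d = 0" by (simp add: c T_def inner_sum_right)
    moreover have "(x v - \<pi> (x v)) \<bullet> d = 0" by (rule \<pi>(4)[OF d])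
    ultimately have "d \<bullet> d = 0"
      using ox by (simp add: d_def inner_diff linear_diff)
    then show ?thesis by (simp add: d_def)
  qed
  define C where "C = D \<circ> \<pi>"
  have C: "linear C" unfolding C_def by (rule linear_compose[OF \<pi>(1) D])
  have C_comm: "C (x v) = x (C v)" if "x \<in> S" for x v
    by (simp add: C_def \<pi>_comm[OF that] D_comm[OF that] \<pi>(2))
  define C' where "C' = adjoint C"
  have C': "linear C'" "C' v \<bullet> w = v \<bullet> C w" for v w
    unfolding C'_def using adjoint_linear[OF C] adjoint_works[OF C]
    by (auto simp: inner_commute)
  have C'_comm: "C' (x v) = x (C' v)" if x: "x \<in> S" for x v
  proof -
    note ox = S[OF x]
    have "(C' (x v) - x (C' v)) \<bullet> z = 0" for z
    proof -
      obtain z' where z: "z = x z'"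
        using orthogonal_transformation_surj[OF ox] by (metis surjD)
      have "C' (x v) \<bullet> z = x v \<bullet> x (C z')" by (simp add: C'(2) z C_comm[OF x])
      also have "\<dots> = x (C' v) \<bullet> z"
        using ox by (simp add: z C'(2) orthogonal_transformation_def)
      finally show ?thesis by (simp add: inner_diff_left)
    qed
    from this[of "C' (x v) - x (C' v)"] show ?thesis by simp
  qed
  define A where "A v = C v - C' v + C' (\<pi> v)" for v
  show thesis
  proof
    show "linear A"
      unfolding A_def
      using linear_compose[OF \<pi>(1) C'(1)]
      by (intro linear_compose_add linear_compose_sub C C') (simp add: o_def)
    show "A v \<bullet> z = - (v \<bullet> A z)" for v z
    proof -
      have "\<pi> v \<bullet> C z + C v \<bullet> \<pi> z = 0"
        using D_skew[OF \<pi>(2) \<pi>(2), of v z] by (simp add: C_def)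
      then show ?thesis
        using C'(2)[of v z] C'(2)[of z v] C'(2)[of "\<pi> v" z] C'(2)[of "\<pi> z" v]
        by (simp add: A_def inner_add_left inner_diff_left inner_add_right inner_diff_right
            inner_commute)
    qed
    show "A (x v) = x (A v)" if "x \<in> S" for x v
      using S[OF that]
      by (simp add: A_def C_comm[OF that] C'_comm[OF that] \<pi>_comm[OF that] orthogonal_transformation_def
          linear_add linear_diff)
    show "A (a i) = w i" for i
      by (simp add: A_def C_def \<pi>(3) aW' Da)
  qed
qed

text \<open>
  Distances determine the Gram matrix of a point set centred at the origin: \<open>M\<close> stands for the
  difference of two such Gram matrices, and the second assumption says that the squared distances
  are equal.
\<close>
lemma centered_matrix_eq_0:
  fixes M :: "'v::finite \<Rightarrow> 'v \<Rightarrow> real"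
  assumes rows: "\<And>i. (\<Sum>j\<in>UNIV. M i j) = 0"
    and eq: "\<And>i j. M i i + M j j = 2 * M i j"
  shows "M i j = 0"
proof -
  define n where "n = real CARD('v)"
  have n: "n > 0" by (simp add: n_def)
  define \<tau> where "\<tau> = (\<Sum>j\<in>UNIV. M j j)"
  have row: "n * M i i + \<tau> = 0" for i
  proof -
    have "n * M i i + \<tau> = (\<Sum>j\<in>UNIV. M i i + M j j)"
      by (simp add: sum.distrib \<tau>_def n_def)
    also have "\<dots> = 2 * (\<Sum>j\<in>UNIV. M i j)" by (simp add: eq sum_distrib_left)
    finally show ?thesis by (simp add: rows)
  qed
  have "(\<Sum>i\<in>UNIV. n * M i i + \<tau>) = 0" by (simp add: row)
  then have "n * \<tau> + n * \<tau> = 0"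
    by (simp add: sum.distrib \<tau>_def n_def sum_distrib_left)
  then have "\<tau> = 0" using n by simp
  then have "M i i = 0" for i using row[of i] n by simp
  then show ?thesis using eq[of i j] by simp
qed

text \<open>The arithmetic mean of the points: a base point that is fixed by every symmetry of \<open>x\<close>.\<close>
definition centroid :: "'a::euclidean_space ^ 'v::finite \<Rightarrow> 'a" where
  "centroid x = (1 / real CARD('v)) *\<^sub>R (\<Sum>i\<in>UNIV. x $ i)"

lemma linear_centroid: "linear centroid"
  unfolding centroid_def
  by (rule linearI) (auto simp: sum.distrib scaleR_add_right scaleR_sum_right mult.commute)

lemma sum_diff_centroid: "(\<Sum>i\<in>UNIV. x $ i - centroid x) = 0"
  by (simp add: sum_subtractf centroid_def sum_constant_scaleR)

lemma centroid_fixed: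
  assumes "x \<in> S" "linear x" "bij (\<Phi> x)" "p \<in> symmetric_configs S \<Phi>"
  shows "x (centroid p) = centroid p"
proof -
  have "x (centroid p) = (1 / real CARD('b)) *\<^sub>R (\<Sum>i\<in>UNIV. p $ \<Phi> x i)"
    using assms by (simp add: centroid_def linear_scale linear_sum symmetric_configs_def)
  also have "(\<Sum>i\<in>UNIV. p $ \<Phi> x i) = (\<Sum>i\<in>UNIV. p $ i)"
    using assms(3) by (rule sum.reindex_bij_betw)
  finally show ?thesis by (simp add: centroid_def)
qed

text \<open>
  The initial velocity of a path of configurations congruent to \<open>p\<close> is a trivial infinitesimal
  motion, even if \<open>p\<close> lies in a proper affine subspace.  Relative to the centroids the Gram matrix
  is constant along the path, hence so are the linear relations among the points; the velocity
  inherits these relations.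
\<close>
lemma trivial_inf_motion_of_congruent_path:
  fixes p u :: "'a::euclidean_space ^ 'v::finite"
  assumes S: "\<And>x. x \<in> S \<Longrightarrow> orthogonal_transformation x"
    and \<Phi>: "\<And>x. x \<in> S \<Longrightarrow> bij (\<Phi> x)"
    and p: "p \<in> symmetric_configs S \<Phi>" and u: "u \<in> symmetric_configs S \<Phi>"
    and lim: "((\<lambda>t. (1 / t) *\<^sub>R h t) \<longlongrightarrow> u) (at_right (0::real))"
    and cong: "\<forall>\<^sub>F t in at_right 0. \<forall>i j. norm ((p + h t) $ i - (p + h t) $ j) = norm (p $ i - p $ j)"
  shows "trivial_inf_motion S p u"
proof -
  define a where "a i = p $ i - centroid p" for i
  define w where "w i = u $ i - centroid u" for i
  define k where "k t i = h t $ i - centroid (h t)" for t i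
  have suma: "(\<Sum>i\<in>UNIV. a i) = 0" and sumw: "(\<Sum>i\<in>UNIV. w i) = 0"
    and sumk: "(\<Sum>i\<in>UNIV. k t i) = 0" for t
    unfolding a_def w_def k_def by (rule sum_diff_centroid)+
  have klim: "((\<lambda>t. (1 / t) *\<^sub>R k t i) \<longlongrightarrow> w i) (at_right 0)" for i
  proof -
    have l: "linear (\<lambda>x :: 'a ^ 'v. x $ i - centroid x)"
      by (intro linear_compose_sub linear_centroid) (simp add: linear_iff)
    then have "((\<lambda>t. ((1 / t) *\<^sub>R h t) $ i - centroid ((1 / t) *\<^sub>R h t)) \<longlongrightarrow> w i) (at_right 0)"
      unfolding w_def
      using linear_conv_bounded_linear bounded_linear.tendsto lim by blast
    then show ?thesis
      using linear_scale[OF l] by (simp add: k_def scaleR_diff_right linear_scale[OF linear_centroid])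
  qed
  have gram: "\<forall>\<^sub>F t in at_right 0. \<forall>i j. (a i + k t i) \<bullet> (a j + k t j) = a i \<bullet> a j"
    using cong
  proof (rule eventually_mono, intro allI)
    fix t i j
    assume eq: "\<forall>i j. norm ((p + h t) $ i - (p + h t) $ j) = norm (p $ i - p $ j)"
    have "norm ((a i + k t i) - (a j + k t j)) = norm (a i - a j)" for i j
      using eq[rule_format, of i j] by (simp add: a_def k_def algebra_simps)
    then have sq: "((a i + k t i) - (a j + k t j)) \<bullet> ((a i + k t i) - (a j + k t j)) =
        (a i - a j) \<bullet> (a i - a j)" for i j
      by (simp add: dot_square_norm)
    have "(a i + k t i) \<bullet> (a j + k t j) - a i \<bullet> a j = 0"
    proof (rule centered_matrix_eq_0[of "\<lambda>i j. (a i + k t i) \<bullet> (a j + k t j) - a i \<bullet> a j"])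
      fix i
      show "(\<Sum>j\<in>UNIV. (a i + k t i) \<bullet> (a j + k t j) - a i \<bullet> a j) = 0"
        by (simp add: sum_subtractf sum.distrib suma sumk flip: inner_sum_right)
    next
      fix i j
      show "((a i + k t i) \<bullet> (a i + k t i) - a i \<bullet> a i) + ((a j + k t j) \<bullet> (a j + k t j) - a j \<bullet> a j) =
          2 * ((a i + k t i) \<bullet> (a j + k t j) - a i \<bullet> a j)"
        using sq[of i j]
          inner_diff_left[of "a i + k t i" "a j + k t j"] inner_commute[of "a i + k t i" "a j + k t j"]
        by (simp add: inner_diff_right inner_diff_left inner_commute[of "a i" "a j"])
    qed
    then show "(a i + k t i) \<bullet> (a j + k t j) = a i \<bullet> a j" by simp
  qed
  have pos: "\<forall>\<^sub>F t in at_right (0::real). t > 0" by (rule eventually_at_right_less)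
  have skew: "a i \<bullet> w j + w i \<bullet> a j = 0" for i j
  proof -
    have "((\<lambda>t. a i \<bullet> ((1/t) *\<^sub>R k t j) + ((1/t) *\<^sub>R k t i) \<bullet> a j
        + t * (((1/t) *\<^sub>R k t i) \<bullet> ((1/t) *\<^sub>R k t j))) \<longlongrightarrow>
        a i \<bullet> w j + w i \<bullet> a j + 0 * (w i \<bullet> w j)) (at_right 0)"
      by (intro tendsto_intros klim)
    moreover have "\<forall>\<^sub>F t in at_right 0. a i \<bullet> ((1/t) *\<^sub>R k t j) + ((1/t) *\<^sub>R k t i) \<bullet> a j
        + t * (((1/t) *\<^sub>R k t i) \<bullet> ((1/t) *\<^sub>R k t j)) = 0"
      using gram pos
    proof eventually_elim
      case (elim t)
      have "a i \<bullet> k t j + k t i \<bullet> a j + k t i \<bullet> k t j = 0"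
        using elim(1)[rule_format, of i j] by (simp add: inner_add_left inner_add_right)
      then have "(1/t) * (a i \<bullet> k t j + k t i \<bullet> a j + k t i \<bullet> k t j) = 0" by simp
      then show ?case using elim(2) by (simp add: field_simps)
    qed
    ultimately have "((\<lambda>t::real. 0::real) \<longlongrightarrow> a i \<bullet> w j + w i \<bullet> a j + 0 * (w i \<bullet> w j)) (at_right 0)"
      by (rule Lim_transform_eventually)
    then show ?thesis by (simp add: tendsto_const_iff)
  qed
  have dep: "(\<Sum>i\<in>UNIV. c i *\<^sub>R w i) = 0" if c: "(\<Sum>i\<in>UNIV. c i *\<^sub>R a i) = 0" for c
  proof -
    have "((\<lambda>t. \<Sum>i\<in>UNIV. c i *\<^sub>R ((1/t) *\<^sub>R k t i)) \<longlongrightarrow> (\<Sum>i\<in>UNIV. c i *\<^sub>R w i)) (at_right 0)"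
      by (intro tendsto_intros klim)
    moreover have "\<forall>\<^sub>F t in at_right 0. (\<Sum>i\<in>UNIV. c i *\<^sub>R ((1/t) *\<^sub>R k t i)) = 0"
      using gram
    proof eventually_elim
      case (elim t)
      have "(\<Sum>i\<in>UNIV. c i *\<^sub>R (a i + k t i)) \<bullet> (\<Sum>i\<in>UNIV. c i *\<^sub>R (a i + k t i)) =
          (\<Sum>i\<in>UNIV. c i *\<^sub>R a i) \<bullet> (\<Sum>i\<in>UNIV. c i *\<^sub>R a i)"
        using elim by (simp add: inner_sum_left inner_sum_right)
      then have "(\<Sum>i\<in>UNIV. c i *\<^sub>R (a i + k t i)) = 0" by (simp add: c)
      then have "(\<Sum>i\<in>UNIV. c i *\<^sub>R k t i) = 0" by (simp add: scaleR_add_right sum.distrib c)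
      then have "(1/t) *\<^sub>R (\<Sum>i\<in>UNIV. c i *\<^sub>R k t i) = 0" by simp
      then show ?case by (simp add: scaleR_sum_right mult.commute)
    qed
    ultimately have "((\<lambda>t::real. 0) \<longlongrightarrow> (\<Sum>i\<in>UNIV. c i *\<^sub>R w i)) (at_right 0)"
      by (rule Lim_transform_eventually)
    then show ?thesis by (simp add: tendsto_const_iff)
  qed
  have lin: "linear x" if "x \<in> S" for x using S[OF that] by (simp add: orthogonal_transformation_def)
  have fixc: "x (centroid p) = centroid p" "x (centroid u) = centroid u" if "x \<in> S" for x
    using centroid_fixed[of x S \<Phi>] that lin \<Phi> p u by auto
  obtain A where A: "linear A" "\<And>v w. A v \<bullet> w = - (v \<bullet> A w)"
    "\<And>x v. x \<in> S \<Longrightarrow> A (x v) = x (A v)" "\<And>i. A (a i) = w i"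
  proof (rule skew_map_exists[of a w S \<Phi>])
    fix x i assume x: "x \<in> S"
    show "x (a i) = a (\<Phi> x i)" "x (w i) = w (\<Phi> x i)"
      using p u x fixc[OF x] by (auto simp: a_def w_def symmetric_configs_def linear_diff[OF lin[OF x]])
  qed (use skew dep S \<Phi> in \<open>auto simp: bij_is_surj\<close>)
  have "u $ i = A (p $ i) + (centroid u - A (centroid p))" for i
    using A(4)[of i] by (simp add: a_def w_def linear_diff[OF A(1)] algebra_simps)
  moreover have "x (centroid u - A (centroid p)) = centroid u - A (centroid p)" if "x \<in> S" for x
    using A(3)[OF that, of "centroid p"] fixc[OF that] by (simp add: linear_diff[OF lin[OF that]])
  ultimately show ?thesis using A unfolding trivial_inf_motion_def by blast
qed

section \<open>Finite flexes and infinitesimal motions\<close>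

lemma real_analytic_on_continuous_at_0:
  fixes y :: "real \<Rightarrow> 'x::euclidean_space"
  assumes "real_analytic_on y {0..1}"
  shows "(y \<longlongrightarrow> y 0) (at_right 0)"
proof -
  obtain r c where r: "r > 0"
    and y: "\<And>t. t \<in> {0..1} \<Longrightarrow> \<bar>t\<bar> < r \<Longrightarrow> (\<lambda>k. t ^ k *\<^sub>R c k) sums y t"
  proof -
    have "\<exists>r>0. \<exists>c. \<forall>t\<in>{0..1}. \<bar>t - 0\<bar> < r \<longrightarrow> (\<lambda>k. (t - 0) ^ k *\<^sub>R c k) sums y t"
      using assms unfolding real_analytic_on_def by (rule bspec) simp
    then obtain r c where rc: "r > 0" "\<forall>t\<in>{0..1}. \<bar>t\<bar> < r \<longrightarrow> (\<lambda>k. t ^ k *\<^sub>R c k) sums y t"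
      by auto
    show thesis by (rule that[of r c]) (use rc in auto)
  qed
  define s where "s = min r 1 / 2"
  have s: "s > 0" "s < r" "s < 1" using r by (auto simp: s_def min_def)
  have "((\<lambda>t. y t \<bullet> e) \<longlongrightarrow> y 0 \<bullet> e) (at_right 0)" for e
  proof -
    have coord: "(\<lambda>k. (c k \<bullet> e) * t ^ k) sums (y t \<bullet> e)" if "t \<ge> 0" "t \<le> s" for t
      using bounded_linear.sums[OF bounded_linear_inner_left y, of t e] that s
      by (simp add: mult.commute)
    define f where "f t = (\<Sum>k. (c k \<bullet> e) * t ^ k)" for t
    have f: "f t = y t \<bullet> e" if "t \<ge> 0" "t \<le> s" for t
      using coord[OF that] by (simp add: f_def sums_iff)
    have "isCont f 0"
      unfolding f_def
      by (rule isCont_powser[of _ s]) (use coord[of s] s in \<open>auto simp: sums_iff\<close>)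
    then have "(f \<longlongrightarrow> f 0) (at_right 0)"
      unfolding isCont_def by (rule tendsto_within_subset) simp
    moreover have "\<forall>\<^sub>F t in at_right 0. f t = y t \<bullet> e"
      unfolding eventually_at_right_field using s(1) f by (intro exI[of _ s]) auto
    ultimately show ?thesis
      using f[of 0] s by (auto intro: Lim_transform_eventually)
  qed
  then show ?thesis by (subst tendsto_componentwise_iff) blast
qed

lemma symmetric_inf_motions_complete_subset:
  assumes "simple_graph E"
  shows "symmetric_inf_motions complete_graph S \<Phi> x \<subseteq> symmetric_inf_motions E S \<Phi> x"
  by (auto simp: symmetric_inf_motions_def edge_form_eq_0_iff[OF assms]
      edge_form_complete_eq_0_iff)

lemma dim_symmetric_inf_motions:
  assumes E: "simple_graph E" and S: "\<And>x. x \<in> S \<Longrightarrow> linear x"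
  shows "dim (symmetric_inf_motions E S \<Phi> x) + dim (edge_form E x ` symmetric_configs S \<Phi>) =
    dim (symmetric_configs S \<Phi>)"
  unfolding symmetric_inf_motions_def
  using bounded_bilinear_edge_form[OF E] subspace_symmetric_configs S
  by (intro dim_kernel_plus_dim_image bounded_linear.linear bounded_bilinear.bounded_linear_right)
    auto

text \<open>
  Infinitesimal rigidity implies rigidity.  The trivial motions extend to vector fields of
  infinitesimal motions of the complete graph; by semicontinuity these still span the kernel at all
  symmetric configurations near \<open>p\<close>.  Applied to midpoints, this shows that motions
  starting at \<open>p\<close> preserve all distances for a short time.
\<close>
lemma no_symmetric_finite_flex:
  fixes p :: "'a::euclidean_space ^ 'v::finite"
  assumes E: "simple_graph E" and S: "\<And>x. x \<in> S \<Longrightarrow> linear x"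
    and p: "p \<in> symmetric_configs S \<Phi>"
    and triv: "\<And>u. u \<in> symmetric_inf_motions E S \<Phi> p \<Longrightarrow> trivial_inf_motion S p u"
  shows "\<not> symmetric_finite_flex E S \<Phi> p y"
proof
  assume y: "symmetric_finite_flex E S \<Phi> p y"
  let ?P = "symmetric_configs S \<Phi>"
  let ?M = "symmetric_inf_motions E S \<Phi>" and ?T = "symmetric_inf_motions complete_graph S \<Phi>"
  have P: "subspace ?P" using S by (rule subspace_symmetric_configs)
  have dims: "dim (?M x) + dim (edge_form E x ` ?P) = dim ?P" for x
    using E S by (rule dim_symmetric_inf_motions)
  obtain C where C: "C \<subseteq> ?M p" "independent C" "card C = dim (?M p)"
    using basis_exists[of "?M p"] by metis
  have "\<forall>c\<in>C. \<exists>v. (v \<longlongrightarrow> c) (nhds p) \<and> (\<forall>x\<in>?P. v x \<in> ?T x)"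
  proof
    fix c assume "c \<in> C"
    then have "trivial_inf_motion S p c" using triv C(1) by blast
    then obtain A b where A: "linear A" "\<And>v w. A v \<bullet> w = - (v \<bullet> A w)"
      "\<And>x v. x \<in> S \<Longrightarrow> A (x v) = x (A v)" "\<And>x. x \<in> S \<Longrightarrow> x b = b" "\<And>i. c $ i = A (p $ i) + b"
      unfolding trivial_inf_motion_def by metis
    define v where "v x = (\<chi> i. A (x $ i) + b)" for x :: "'a ^ 'v"
    have "((\<lambda>x. A (x $ i) + b) \<longlongrightarrow> A (p $ i) + b) (nhds p)" for i
      using A(1) by (intro tendsto_intros filterlim_ident bounded_linear.tendsto[of A])
        (simp add: linear_conv_bounded_linear)
    then have "(v \<longlongrightarrow> v p) (nhds p)" unfolding v_def by (rule tendsto_vec_lambda)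
    moreover have "v p = c" by (simp add: v_def vec_eq_iff A(5))
    moreover have "v x \<in> ?T x" if x: "x \<in> ?P" for x
    proof -
      have "(x $ i - x $ j) \<bullet> (A (x $ i) - A (x $ j)) = 0" for i j
        using A(2)[of "x $ i - x $ j" "x $ i - x $ j"]
        by (simp add: linear_diff[OF A(1)] inner_commute)
      moreover have "v x \<in> ?P"
        using x A(3,4) S by (auto simp: v_def symmetric_configs_def linear_add simp flip: A(3))
      ultimately show ?thesis
        by (simp add: symmetric_inf_motions_def edge_form_complete_eq_0_iff v_def)
    qed
    ultimately show "\<exists>v. (v \<longlongrightarrow> c) (nhds p) \<and> (\<forall>x\<in>?P. v x \<in> ?T x)" by metis
  qed
  then obtain v where v: "\<And>c. c \<in> C \<Longrightarrow> (v c \<longlongrightarrow> c) (nhds p)"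
    "\<And>c x. c \<in> C \<Longrightarrow> x \<in> ?P \<Longrightarrow> v c x \<in> ?T x"
    by metis
  have "\<forall>\<^sub>F x in nhds p. \<forall>W. subspace W \<longrightarrow> (\<forall>c\<in>C. v c x \<in> W) \<longrightarrow> card C \<le> dim W"
    using C(2) v(1) by (rule eventually_card_le_dim)
  then have "\<forall>\<^sub>F x in nhds p. x \<in> ?P \<longrightarrow> ?M x = ?T x"
    using eventually_rank_le[OF bounded_bilinear_edge_form[OF E] P]
  proof eventually_elim
    case (elim x)
    show ?case
    proof
      assume x: "x \<in> ?P"
      have sub: "subspace (?T x)" "subspace (?M x)"
        using subspace_symmetric_inf_motions E simple_graph_complete_graph S by blast+
      have "dim (?M p) \<le> dim (?T x)" using elim(1) sub(1) v(2) x C(3) by force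
      moreover have "dim (?M x) \<le> dim (?M p)"
        using elim(2) dims[of p]
          dims[of x] by simp
      ultimately show "?M x = ?T x"
        using subspace_dim_equal[OF sub symmetric_inf_motions_complete_subset[OF E]] by simp
    qed
  qed
  moreover have "((\<lambda>t. p + (1/2) *\<^sub>R (y t - p)) \<longlongrightarrow> p + (1/2) *\<^sub>R (p - p)) (at_right 0)"
    using real_analytic_on_continuous_at_0[of y] y
    by (intro tendsto_intros)
      (auto simp: symmetric_finite_flex_def finite_flex_def finite_motion_def)
  ultimately have "\<forall>\<^sub>F t in at_right 0. p + (1/2) *\<^sub>R (y t - p) \<in> ?P \<longrightarrow>
      ?M (p + (1/2) *\<^sub>R (y t - p)) = ?T (p + (1/2) *\<^sub>R (y t - p))"
    by (auto simp: filterlim_iff)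
  moreover have "\<forall>\<^sub>F t in at_right 0. t \<in> {0<..<(1::real)}"
    by (rule eventually_at_right_real) simp
  ultimately have "\<forall>\<^sub>F t in at_right (0::real). False"
  proof eventually_elim
    case (elim t)
    let ?h = "y t - p" and ?m = "p + (1/2) *\<^sub>R (y t - p)"
    have yt: "y t \<in> ?P" "edge_function E (y t) = edge_function E p"
      "edge_function complete_graph (y t) \<noteq> edge_function complete_graph p"
      using y elim(2) by (auto simp: symmetric_finite_flex_def finite_flex_def finite_motion_def)
    have h: "?h \<in> ?P" using P yt(1) p by (rule subspace_diff)
    then have "?m \<in> ?P" using P p by (intro subspace_add subspace_scale)
    moreover have "edge_form E ?m ?h = 0"
      using edge_function_add[OF E, of p ?h] yt(2) by simp
    ultimately have "?h \<in> ?T ?m" using h elim(1) by (auto simp: symmetric_inf_motions_def)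
    then have "edge_function complete_graph (y t) = edge_function complete_graph p"
      using edge_function_add[OF simple_graph_complete_graph, of p ?h]
      by (simp add: symmetric_inf_motions_def)
    with yt(3) show False by simp
  qed
  then show False by (simp add: trivial_limit_at_right_real)
qed

lemma bounded_bilinear_linear_compose:
  fixes \<beta> :: "'x::euclidean_space \<Rightarrow> 'y::euclidean_space \<Rightarrow> 'z::euclidean_space"
    and f :: "'z \<Rightarrow> 'w::euclidean_space"
  assumes f: "linear f" and \<beta>: "bounded_bilinear \<beta>"
  shows "bounded_bilinear (\<lambda>x y. f (\<beta> x y))"
proof -
  have "bilinear \<beta>" using \<beta> by (simp add: bilinear_conv_bounded_bilinear)
  then have "bilinear (\<lambda>x y. f (\<beta> x y))"
    unfolding bilinear_def using linear_compose[OF _ f, of "\<beta> x" for x] linear_compose[OF _ f, of "\<lambda>x. \<beta> x y" for y]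
    by (simp add: o_def)
  then show ?thesis by (simp add: bilinear_conv_bounded_bilinear)
qed

text \<open>
  At a regular point a nontrivial symmetric infinitesimal motion \<open>u\<close> extends to an analytic flex.
  Let \<open>\<beta>\<close> be the edge form, \<open>R\<close> the range of \<open>\<beta> p\<close> on symmetric configurations, \<open>\<pi>\<close> the
  projection onto \<open>R\<close> and \<open>g\<close> a right inverse of \<open>\<beta> p\<close> over \<open>R\<close>.  The series solution of
  \<open>h = t u - g (\<pi> (\<beta> h h)) / 2\<close> satisfies \<open>\<pi> (\<beta> (p + h/2) h) = 0\<close>; by constancy of the rank
  \<open>\<pi>\<close> may be dropped, and \<open>p + h(t)\<close> is a motion.  Some distance is not constant along it,
  as otherwise its velocity \<open>u\<close> would be trivial, and by analyticity this distance differs from its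
  initial value for all small \<open>t > 0\<close>.
\<close>
lemma symmetric_finite_flex_exists:
  fixes p :: "'a::euclidean_space ^ 'v::finite"
  assumes E: "simple_graph E" and S: "\<And>x. x \<in> S \<Longrightarrow> orthogonal_transformation x"
    and \<Phi>: "\<And>x. x \<in> S \<Longrightarrow> bij (\<Phi> x)"
    and p: "p \<in> symmetric_configs S \<Phi>"
    and reg: "\<forall>\<^sub>F x in nhds p. x \<in> symmetric_configs S \<Phi> \<longrightarrow>
      dim (symmetric_inf_motions E S \<Phi> p) \<le> dim (symmetric_inf_motions E S \<Phi> x)"
    and u: "u \<in> symmetric_inf_motions E S \<Phi> p" and nontriv: "\<not> trivial_inf_motion S p u"
  shows "\<exists>y. symmetric_finite_flex E S \<Phi> p y"
proof -
  let ?P = "symmetric_configs S \<Phi>"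
  let ?\<beta> = "edge_form E :: 'a ^ 'v \<Rightarrow> 'a ^ 'v \<Rightarrow> _"
  let ?\<kappa> = "edge_form complete_graph :: 'a ^ 'v \<Rightarrow> 'a ^ 'v \<Rightarrow> _"
  have lin: "linear x" if "x \<in> S" for x
    using S[OF that] by (simp add: orthogonal_transformation_def)
  have P: "subspace ?P" using lin by (rule subspace_symmetric_configs)
  have uP: "u \<in> ?P" and \<beta>u: "?\<beta> p u = 0" using u by (auto simp: symmetric_inf_motions_def)
  have bil: "bounded_bilinear ?\<beta>" by (rule bounded_bilinear_edge_form[OF E])
  interpret \<beta>: bounded_bilinear ?\<beta> by (rule bil)
  have bil\<kappa>: "bounded_bilinear ?\<kappa>"
    by (rule bounded_bilinear_edge_form[OF simple_graph_complete_graph])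
  interpret \<kappa>: bounded_bilinear ?\<kappa> by (rule bil\<kappa>)
  have lin\<beta>: "linear (?\<beta> x)" for x by (intro bounded_linear.linear \<beta>.bounded_linear_right)
  have dims: "dim (symmetric_inf_motions E S \<Phi> x) + dim (?\<beta> x ` ?P) = dim ?P" for x
    using E lin by (rule dim_symmetric_inf_motions)
  define R where "R = ?\<beta> p ` ?P"
  have R: "subspace R" unfolding R_def by (rule linear_subspace_image[OF lin\<beta> P])
  obtain \<pi> where \<pi>: "linear \<pi>" "\<And>v. \<pi> v \<in> R" "\<And>w. w \<in> R \<Longrightarrow> \<pi> w = w"
    by (rule orthogonal_projection_exists[OF R]) blast
  obtain g where g: "range g \<subseteq> ?P" "linear g" "\<And>v. v \<in> R \<Longrightarrow> ?\<beta> p (g v) = v"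
    using linear_exists_right_inverse_on[OF lin\<beta> P, of p] unfolding R_def by blast
  have bil\<pi>: "bounded_bilinear (\<lambda>x z. \<pi> (?\<beta> x z))"
    by (rule bounded_bilinear_linear_compose[OF \<pi>(1) bil])
  \<comment> \<open>Near \<open>p\<close> the rank of the edge form is at most \<open>dim R\<close>, by regularity, while its composition with \<open>\<pi>\<close> has at least this rank; so \<open>\<pi>\<close> is injective on its range.\<close>
  have "\<forall>\<^sub>F x in nhds p. x \<in> ?P \<longrightarrow> (\<forall>z\<in>?P. \<pi> (?\<beta> x z) = 0 \<longrightarrow> ?\<beta> x z = 0)"
    using eventually_rank_le[OF bil\<pi> P, of p] reg
  proof eventually_elim
    case (elim x)
    show ?case
    proof (intro impI ballI)
      fix z assume x: "x \<in> ?P" and z: "z \<in> ?P" "\<pi> (?\<beta> x z) = 0"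
      have sub: "subspace (?\<beta> x ` ?P)" by (rule linear_subspace_image[OF lin\<beta> P])
      have "dim (?\<beta> x ` ?P) \<le> dim R"
        using elim(2) x dims[of p]
          dims[of x] by (simp add: R_def)
      also have "R = (\<lambda>z. \<pi> (?\<beta> p z)) ` ?P"
        unfolding R_def by (intro image_cong refl sym[OF \<pi>(3)]) (auto simp: R_def)
      also have "dim \<dots> \<le> dim ((\<lambda>z. \<pi> (?\<beta> x z)) ` ?P)" by (rule elim(1))
      finally have "dim {v \<in> ?\<beta> x ` ?P. \<pi> v = 0} = 0"
        using dim_kernel_plus_dim_image[OF \<pi>(1) sub] by (simp add: image_image del: dim_eq_0)
      then show "?\<beta> x z = 0" using z by (auto simp: dim_eq_0)
    qed
  qed
  then obtain \<delta> where \<delta>: "\<delta> > 0"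
    "\<And>x z. dist x p < \<delta> \<Longrightarrow> x \<in> ?P \<Longrightarrow> z \<in> ?P \<Longrightarrow> \<pi> (?\<beta> x z) = 0 \<Longrightarrow> ?\<beta> x z = 0"
    unfolding eventually_nhds_metric by blast
  \<comment> \<open>Since \<open>\<beta> p u = 0\<close>, the equation \<open>h = t u + \<gamma>(h, h)\<close> implies \<open>\<pi> (\<beta> p h + \<beta> h h / 2) = 0\<close>.\<close>
  define \<gamma> where "\<gamma> x z = - (1/2) *\<^sub>R g (\<pi> (?\<beta> x z))" for x z
  have bil\<gamma>: "bounded_bilinear \<gamma>"
  proof -
    have "linear (\<lambda>v. - (1/2) *\<^sub>R g v)" using g(2) by (rule linear_compose_scale_right)
    then show ?thesis unfolding \<gamma>_def using bil\<pi> by (rule bounded_bilinear_linear_compose)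
  qed
  have \<gamma>P: "\<gamma> x z \<in> ?P" for x z
    using g(1) by (auto simp: \<gamma>_def intro!: subspace_scale[OF P] subspace_neg[OF P])
  obtain r c h where r: "r > 0" and c0: "c 0 = 0"
    and summ: "\<And>t. \<bar>t\<bar> < r \<Longrightarrow> summable (\<lambda>k. norm (t ^ k *\<^sub>R c k))"
    and sums: "\<And>t. \<bar>t\<bar> < r \<Longrightarrow> (\<lambda>k. t ^ k *\<^sub>R c k) sums h t"
    and fixpt: "\<And>t. \<bar>t\<bar> < r \<Longrightarrow> h t = t *\<^sub>R u + \<gamma> (h t) (h t)"
    and small: "\<And>t. \<bar>t\<bar> < r \<Longrightarrow> norm (h t) \<le> 2 * norm u * \<bar>t\<bar>"
    and hP: "\<And>t. \<bar>t\<bar> < r \<Longrightarrow> h t \<in> ?P"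
    by (rule quadratic_fixed_point_series[OF bil\<gamma> P uP \<gamma>P]) blast
  have h0: "h 0 = 0" using small[of 0] r by simp
  have lim: "((\<lambda>t. (1/t) *\<^sub>R h t) \<longlongrightarrow> u) (at_right 0)"
  proof -
    obtain K where K: "K > 0" "\<And>x z. norm (\<gamma> x z) \<le> norm x * norm z * K"
      using bounded_bilinear.pos_bounded[OF bil\<gamma>] by blast
    have "((\<lambda>t. (1/t) *\<^sub>R h t - u) \<longlongrightarrow> 0) (at_right 0)"
    proof (rule Lim_null_comparison)
      have "((\<lambda>t. (4 * (norm u)\<^sup>2 * K) * t) \<longlongrightarrow> (4 * (norm u)\<^sup>2 * K) * 0) (at_right 0)"
        by (intro tendsto_intros)
      then show "((\<lambda>t. (4 * (norm u)\<^sup>2 * K) * t) \<longlongrightarrow> 0) (at_right 0)" by simp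
      have "\<forall>\<^sub>F t in at_right 0. t \<in> {0<..<r}" by (rule eventually_at_right_real) (rule r)
      then show "\<forall>\<^sub>F t in at_right 0. norm ((1/t) *\<^sub>R h t - u) \<le> (4 * (norm u)\<^sup>2 * K) * t"
      proof (rule eventually_mono)
        fix t assume "t \<in> {0<..<r}"
        then have t: "t > 0" "\<bar>t\<bar> < r" by auto
        have "(1/t) *\<^sub>R h t - u = (1/t) *\<^sub>R \<gamma> (h t) (h t)"
          using t by (subst fixpt[OF t(2)]) (simp add: scaleR_add_right)
        then have "norm ((1/t) *\<^sub>R h t - u) = (1/t) * norm (\<gamma> (h t) (h t))" using t by simp
        also have "\<dots> \<le> (1/t) * ((2 * norm u * t) * (2 * norm u * t) * K)"
          using t K small[OF t(2)]
          by (intro mult_left_mono order_trans[OF K(2)] mult_right_mono mult_mono) auto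
        also have "\<dots> = (4 * (norm u)\<^sup>2 * K) * t" using t by (simp add: power2_eq_square)
        finally show "norm ((1/t) *\<^sub>R h t - u) \<le> (4 * (norm u)\<^sup>2 * K) * t" .
      qed
    qed
    then show ?thesis by (simp add: LIM_zero_iff)
  qed
  \<comment> \<open>For \<open>\<bar>t\<bar> < r'\<close> the midpoint \<open>p + h(t)/2\<close> is within \<open>\<delta>\<close> of \<open>p\<close>.\<close>
  define r' where "r' = min r (\<delta> / (norm u + 1))"
  have pos: "norm u + 1 > 0" by (simp add: add_nonneg_pos)
  have r': "r' > 0" using r \<delta>(1) pos by (simp add: r'_def)
  have motion: "edge_function E (p + h t) = edge_function E p" if t: "\<bar>t\<bar> < r'" for t
  proof -
    have tr: "\<bar>t\<bar> < r" "\<bar>t\<bar> < \<delta> / (norm u + 1)" using t by (auto simp: r'_def)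
    let ?m = "p + (1/2) *\<^sub>R h t"
    have "norm (h t) \<le> 2 * ((norm u + 1) * \<bar>t\<bar>)"
      using small[OF tr(1)] by (simp add: algebra_simps)
    also have "\<dots> < 2 * \<delta>" using tr(2) pos by (simp add: field_simps)
    finally have "dist ?m p < \<delta>" by (simp add: dist_norm)
    moreover have "?m \<in> ?P" by (intro subspace_add subspace_scale P p hP tr)
    moreover have "\<pi> (?\<beta> ?m (h t)) = 0"
    proof -
      have "?\<beta> p (h t) = ?\<beta> p (t *\<^sub>R u + \<gamma> (h t) (h t))" using fixpt[OF tr(1)] by simp
      also have "\<dots> = - (1/2) *\<^sub>R \<pi> (?\<beta> (h t) (h t))"
        by (simp add: \<beta>.add_right \<beta>.scaleR_right \<beta>.minus_right \<beta>.diff_right \<beta>u \<gamma>_def g(3) \<pi>(2))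
      finally have "?\<beta> p (h t) = - (1/2) *\<^sub>R \<pi> (?\<beta> (h t) (h t))" .
      moreover have "\<pi> (?\<beta> p (h t)) = ?\<beta> p (h t)"
        by (rule \<pi>(3)) (use hP[OF tr(1)] in \<open>simp add: R_def\<close>)
      moreover have "\<pi> (?\<beta> ?m (h t)) = \<pi> (?\<beta> p (h t)) + (1/2) *\<^sub>R \<pi> (?\<beta> (h t) (h t))"
        by (simp add: \<beta>.add_left \<beta>.scaleR_left linear_add[OF \<pi>(1)] linear_scale[OF \<pi>(1)])
      ultimately show ?thesis by simp
    qed
    ultimately have "?\<beta> ?m (h t) = 0" by (intro \<delta>(2)[of ?m "h t"] hP[OF tr(1)])
    then show ?thesis using edge_function_add[OF E, of p "h t"] by simp
  qed
  \<comment> \<open>The power series of the change of all squared distances.\<close>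
  define d where "d k = 2 *\<^sub>R ?\<kappa> p (c k) + (\<Sum>i\<le>k. ?\<kappa> (c i) (c (k - i)))" for k
  define \<phi> where "\<phi> t = edge_function complete_graph (p + h t) - edge_function complete_graph p" for t
  have \<phi>: "(\<lambda>k. t ^ k *\<^sub>R d k) sums \<phi> t" if t: "\<bar>t\<bar> < r" for t
  proof -
    have suminf: "(\<Sum>k. t ^ k *\<^sub>R c k) = h t" using sums[OF t] by (rule sums_unique[symmetric])
    have "(\<lambda>k. 2 *\<^sub>R ?\<kappa> p (t ^ k *\<^sub>R c k) + (\<Sum>i\<le>k. ?\<kappa> (t ^ i *\<^sub>R c i) (t ^ (k - i) *\<^sub>R c (k - i))))
        sums (2 *\<^sub>R ?\<kappa> p (h t) + ?\<kappa> (h t) (h t))"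
      using bilinear_Cauchy_product_sums[OF bil\<kappa> summ[OF t] summ[OF t]]
        bounded_linear.sums[OF \<kappa>.bounded_linear_right sums[OF t], of p]
      unfolding suminf by (intro sums_add sums_scaleR_right)
    also have "2 *\<^sub>R ?\<kappa> p (h t) + ?\<kappa> (h t) (h t) = \<phi> t"
      using edge_function_add[OF simple_graph_complete_graph, of p "h t"]
      by (simp add: \<phi>_def \<kappa>.add_left \<kappa>.scaleR_left scaleR_add_right)
    also have "(\<lambda>k. 2 *\<^sub>R ?\<kappa> p (t ^ k *\<^sub>R c k) +
        (\<Sum>i\<le>k. ?\<kappa> (t ^ i *\<^sub>R c i) (t ^ (k - i) *\<^sub>R c (k - i)))) = (\<lambda>k. t ^ k *\<^sub>R d k)"
    proof
      fix k
      have "(\<Sum>i\<le>k. ?\<kappa> (t ^ i *\<^sub>R c i) (t ^ (k - i) *\<^sub>R c (k - i))) =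
          t ^ k *\<^sub>R (\<Sum>i\<le>k. ?\<kappa> (c i) (c (k - i)))"
        unfolding scaleR_sum_right
        by (intro sum.cong) (auto simp: \<kappa>.scaleR_left \<kappa>.scaleR_right power_add[symmetric])
      then show "2 *\<^sub>R ?\<kappa> p (t ^ k *\<^sub>R c k) +
          (\<Sum>i\<le>k. ?\<kappa> (t ^ i *\<^sub>R c i) (t ^ (k - i) *\<^sub>R c (k - i))) = t ^ k *\<^sub>R d k"
        by (simp add: d_def \<kappa>.scaleR_right scaleR_add_right mult.commute)
    qed
    finally show ?thesis .
  qed
  have "\<exists>m. d m \<noteq> 0"
  proof (rule ccontr)
    assume "\<nexists>m. d m \<noteq> 0"
    then have "\<phi> t = 0" if "\<bar>t\<bar> < r" for t using \<phi>[OF that] by (simp add: sums_iff)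
    moreover have "\<forall>\<^sub>F t in at_right 0. t \<in> {0<..<r}" by (rule eventually_at_right_real) (rule r)
    ultimately have "\<forall>\<^sub>F t in at_right 0. \<forall>i j. norm ((p + h t) $ i - (p + h t) $ j) = norm (p $ i - p $ j)"
      by (elim eventually_mono) (simp add: \<phi>_def edge_function_complete_eq_iff)
    with S \<Phi> p uP lim have "trivial_inf_motion S p u"
      by (rule trivial_inf_motion_of_congruent_path)
    with nontriv show False by contradiction
  qed
  then obtain m e where me: "d m $ e \<noteq> 0" by (auto simp: vec_eq_iff)
  have "d 0 = 0" by (simp add: d_def c0 \<kappa>.zero_right)
  then have "m > 0" using me by (cases m) auto
  have \<phi>e: "(\<lambda>k. (d k $ e) * (t - 0) ^ k) sums (\<phi> t $ e)" if "norm (t - 0) < r" for t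
    using bounded_linear.sums[OF bounded_linear_vec_nth \<phi>, of t e] that by (simp add: mult.commute)
  have \<phi>0: "\<phi> 0 $ e = 0" by (simp add: \<phi>_def h0)
  obtain s where s: "s > 0" "\<And>t. t \<in> cball 0 s - {0} \<Longrightarrow> \<phi> t $ e \<noteq> 0"
    using powser_0_nonzero[OF r \<phi>e \<phi>0 me \<open>m > 0\<close>] by metis
  define \<epsilon> where "\<epsilon> = min s (r' / 2)"
  have \<epsilon>: "\<epsilon> > 0" "\<epsilon> \<le> s" "\<epsilon> < r'" using s r' by (auto simp: \<epsilon>_def)
  have \<epsilon>t: "\<bar>\<epsilon> * t\<bar> < r'" if "t \<in> {0..1}" for t
  proof -
    have "\<bar>\<epsilon> * t\<bar> \<le> \<epsilon>" using that \<epsilon>(1) by (simp add: abs_mult mult_left_le)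
    then show ?thesis using \<epsilon>(3) by simp
  qed
  have r'r: "r' \<le> r" by (simp add: r'_def)
  \<comment> \<open>Rescaling time makes all of \<open>[0, 1]\<close> lie in the range of validity.\<close>
  define y where "y t = p + h (\<epsilon> * t)" for t
  have "real_analytic_on y {0..1}"
  proof (rule power_series_real_analytic_on)
    fix t assume "\<bar>t\<bar> < r' / \<epsilon>"
    then have "\<bar>\<epsilon> * t\<bar> < r" using \<epsilon>(1) r'r by (simp add: abs_mult field_simps)
    from sums_add[OF sums_single[of 0 "\<lambda>_. p"] sums[OF this]]
    have "(\<lambda>k. (if k = 0 then p else 0) + (\<epsilon> * t) ^ k *\<^sub>R c k) sums y t"
      by (simp add: y_def)
    also have "(\<lambda>k. (if k = 0 then p else 0) + (\<epsilon> * t) ^ k *\<^sub>R c k) =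
        (\<lambda>k. t ^ k *\<^sub>R ((if k = 0 then p else 0) + \<epsilon> ^ k *\<^sub>R c k))"
    proof
      fix k
      show "(if k = 0 then p else 0) + (\<epsilon> * t) ^ k *\<^sub>R c k =
          t ^ k *\<^sub>R ((if k = 0 then p else 0) + \<epsilon> ^ k *\<^sub>R c k)"
        by (cases "k = 0") (simp_all add: scaleR_add_right power_mult_distrib mult.commute)
    qed
    finally show "(\<lambda>k. t ^ k *\<^sub>R ((if k = 0 then p else 0) + \<epsilon> ^ k *\<^sub>R c k)) sums y t" .
  next
    fix a :: real assume "a \<in> {0..1}"
    then show "\<bar>a\<bar> < r' / \<epsilon>"
      using \<epsilon>t[of a] \<epsilon>(1) by (simp add: abs_mult pos_less_divide_eq mult.commute)
  qed
  moreover have "y 0 = p" by (simp add: y_def h0)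
  moreover have "edge_function E (y t) = edge_function E p" if "t \<in> {0..1}" for t
    unfolding y_def by (rule motion[OF \<epsilon>t[OF that]])
  moreover have "edge_function complete_graph (y t) \<noteq> edge_function complete_graph p"
    if t: "t \<in> {0<..1}" for t
  proof -
    have "\<epsilon> * t \<le> \<epsilon>" by (rule mult_left_le) (use t \<epsilon>(1) in auto)
    then have "\<epsilon> * t \<le> s" using \<epsilon>(2) by (rule order_trans)
    then have "\<epsilon> * t \<in> cball 0 s - {0}" using t \<epsilon> by simp
    from s(2)[OF this] show ?thesis by (auto simp: \<phi>_def y_def)
  qed
  moreover have "y t \<in> ?P" if "t \<in> {0..1}" for t
  proof -
    have "\<bar>\<epsilon> * t\<bar> < r" using \<epsilon>t[OF that] r'r by linarith
    then show ?thesis unfolding y_def by (rule subspace_add[OF P p hP])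
  qed
  ultimately have "symmetric_finite_flex E S \<Phi> p y"
    unfolding symmetric_finite_flex_def finite_flex_def finite_motion_def by blast
  then show ?thesis by blast
qed

section \<open>Regular configurations\<close>

text \<open>
  Differentiability within a proper subspace determines the derivative only on that subspace; this
  suffices for the rank.
\<close>
lemma symmetric_rank_eq:
  fixes x :: "'a::euclidean_space ^ 'v::finite"
  assumes E: "simple_graph E" and S: "\<And>x. x \<in> S \<Longrightarrow> linear x"
    and x: "x \<in> symmetric_configs S \<Phi>"
  shows "symmetric_rank E S \<Phi> x = dim (edge_form E x ` symmetric_configs S \<Phi>)"
proof -
  let ?P = "symmetric_configs S \<Phi> :: ('a ^ 'v) set"
  interpret bounded_bilinear "edge_form E :: 'a ^ 'v \<Rightarrow> _"
    by (rule bounded_bilinear_edge_form[OF E])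
  have P: "subspace ?P" using S by (rule subspace_symmetric_configs)
  define F where "F u = 2 *\<^sub>R edge_form E x u" for u
  have "((\<lambda>z. edge_form E z z) has_derivative (\<lambda>u. edge_form E x u + edge_form E u x)) (at x)"
    by (rule FDERIV[OF has_derivative_ident has_derivative_ident])
  then have F: "(edge_function E has_derivative F) (at x)"
    by (simp add: F_def[abs_def] edge_function_eq_edge_form[abs_def] edge_form_commute[of E _ x]
        scaleR_2)
  define D where "D = frechet_derivative (edge_function E) (at x within ?P)"
  have D: "(edge_function E has_derivative D) (at x within ?P)"
    unfolding D_def
    using has_derivative_at_withinI[OF F] by (metis differentiableI frechet_derivative_works)
  have DF: "D u = F u" if u: "u \<in> ?P" for u
  proof -
    have line: "((\<lambda>t::real. x + t *\<^sub>R u) has_derivative (\<lambda>t. t *\<^sub>R u)) (at 0)"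
      by (auto intro!: derivative_eq_intros)
    have "range (\<lambda>t::real. x + t *\<^sub>R u) \<subseteq> ?P"
      using P x u by (auto intro: subspace_add subspace_scale)
    then have "(edge_function E has_derivative D) (at x within range (\<lambda>t::real. x + t *\<^sub>R u))"
      by (rule has_derivative_subset[OF D])
    then have "(edge_function E has_derivative D)
        (at (x + 0 *\<^sub>R u) within range (\<lambda>t::real. x + t *\<^sub>R u))" by simp
    note has_derivative_in_compose[OF line this]
    moreover have "(edge_function E has_derivative F) (at (x + 0 *\<^sub>R u))" using F by simp
    note has_derivative_compose[OF line this]
    ultimately have "(\<lambda>t. D (t *\<^sub>R u)) = (\<lambda>t. F (t *\<^sub>R u))" by (rule has_derivative_unique)
    from fun_cong[OF this, of 1] show ?thesis by simp
  qed
  have "D ` ?P = edge_form E x ` ?P"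
  proof
    show "D ` ?P \<subseteq> edge_form E x ` ?P"
    proof
      fix z assume "z \<in> D ` ?P"
      then obtain u where u: "u \<in> ?P" "z = F u" using DF by auto
      then have "z = edge_form E x (2 *\<^sub>R u)" by (simp add: F_def scaleR_right)
      then show "z \<in> edge_form E x ` ?P" using subspace_scale[OF P u(1)] by blast
    qed
    show "edge_form E x ` ?P \<subseteq> D ` ?P"
    proof
      fix z assume "z \<in> edge_form E x ` ?P"
      then obtain u where u: "u \<in> ?P" "z = edge_form E x u" by auto
      have "z = D ((1/2) *\<^sub>R u)"
        using DF[OF subspace_scale[OF P u(1)]] u(2) by (simp add: F_def scaleR_right)
      then show "z \<in> D ` ?P" using subspace_scale[OF P u(1)] by blast
    qed
  qed
  then show ?thesis by (simp add: symmetric_rank_def D_def)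
qed

lemma S_regular_imp_dim_le:
  fixes p x :: "'a::euclidean_space ^ 'v::finite"
  assumes E: "simple_graph E" and S: "\<And>x. x \<in> S \<Longrightarrow> linear x"
    and reg: "S_regular E S \<Phi> p"
    and p: "p \<in> symmetric_configs S \<Phi>" and x: "x \<in> symmetric_configs S \<Phi>"
  shows "dim (symmetric_inf_motions E S \<Phi> p) \<le> dim (symmetric_inf_motions E S \<Phi> x)"
proof -
  have "symmetric_rank E S \<Phi> ` symmetric_configs S \<Phi> \<subseteq> {..DIM(real ^ 'v set)}"
    unfolding symmetric_rank_def using dim_subset_UNIV by blast
  then have "finite (symmetric_rank E S \<Phi> ` symmetric_configs S \<Phi>)"
    using finite_subset by blast
  then have "symmetric_rank E S \<Phi> x \<le> symmetric_rank E S \<Phi> p"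
    using reg x unfolding S_regular_def by simp
  moreover have rank_nullity: "symmetric_rank E S \<Phi> y + dim (symmetric_inf_motions E S \<Phi> y) =
      dim (symmetric_configs S \<Phi> :: ('a ^ 'v) set)" if "y \<in> symmetric_configs S \<Phi>" for y
    using symmetric_rank_eq[of E S y \<Phi>] dim_symmetric_inf_motions[of E S \<Phi> y] E S that by simp
  ultimately show ?thesis using rank_nullity[OF p] rank_nullity[OF x] by linarith
qed

section \<open>Infinitesimal motions of cones\<close>

text \<open>The type of a symmetric cone framework fixes the cone vertex and extends the type of the base.\<close>

definition cone_type ::
    "('a::euclidean_space \<Rightarrow> 'a) set \<Rightarrow> (('a \<Rightarrow> 'a) \<Rightarrow> 'v \<Rightarrow> 'v) \<Rightarrow>
     (('a \<times> real \<Rightarrow> 'a \<times> real) \<Rightarrow> 'v option \<Rightarrow> 'v option) \<Rightarrow> bool" where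
  "cone_type S \<Phi> \<Psi> \<longleftrightarrow>
     (\<forall>x\<in>S. \<Psi> (cone_map x) None = None \<and> (\<forall>i. \<Psi> (cone_map x) (Some i) = Some (\<Phi> x i)))"

lemma cone_map_simp [simp]: "cone_map x (v, s) = (x v, s)"
  by (simp add: cone_map_def)

lemma fst_cone_map [simp]: "fst (cone_map x z) = x (fst z)"
  and snd_cone_map [simp]: "snd (cone_map x z) = snd z"
  by (simp_all add: cone_map_def)

lemma orthogonal_cone_map:
  assumes "orthogonal_transformation x"
  shows "orthogonal_transformation (cone_map x)"
proof -
  have "linear (cone_map x)"
    using assms unfolding orthogonal_transformation_def
    by (intro linearI) (auto simp: prod_eq_iff linear_add linear_scale)
  then show ?thesis
    using assms unfolding orthogonal_transformation_def by (simp add: inner_prod_def)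
qed

lemma orthogonal_cone_group:
  assumes "\<And>x. x \<in> S \<Longrightarrow> orthogonal_transformation x" "y \<in> cone_group S"
  shows "orthogonal_transformation y"
  using assms orthogonal_cone_map unfolding cone_group_def by blast

lemma cone_type_of_symmetric_frameworks:
  assumes S: "\<And>x. x \<in> S \<Longrightarrow> linear x"
    and p: "symmetric_framework E S \<Phi> p"
    and q: "symmetric_framework (cone_graph E) (cone_group S) \<Psi> q"
    and q0: "q $ None = 0" and proj: "projects_to q p"
  shows "cone_type S \<Phi> \<Psi>"
  unfolding cone_type_def
proof
  fix x assume x: "x \<in> S"
  obtain \<alpha> where \<alpha>: "\<And>i. \<alpha> i \<noteq> 0" "\<And>i. q $ Some i = \<alpha> i *\<^sub>R (p $ i, 1)"
    using proj unfolding projects_to_def by metis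
  have inj: "q $ j = q $ k \<Longrightarrow> j = k" "p $ l = p $ m \<Longrightarrow> l = m" for j k l m
    using p q by (auto simp: symmetric_framework_def framework_def dest: injD)
  have xp: "x (p $ i) = p $ \<Phi> x i" for i
    using p x by (simp add: symmetric_framework_def symmetric_configs_def)
  have xq: "cone_map x (q $ j) = q $ \<Psi> (cone_map x) j" for j
    using q x by (auto simp: symmetric_framework_def symmetric_configs_def cone_group_def)
  have "cone_map x 0 = 0" using S[OF x] by (simp add: prod_eq_iff linear_0)
  then have None: "\<Psi> (cone_map x) None = None"
    using xq[of None] q0 by (intro inj(1)) simp
  moreover have "\<Psi> (cone_map x) (Some i) = Some (\<Phi> x i)" for i
  proof -
    have q: "q $ \<Psi> (cone_map x) (Some i) = \<alpha> i *\<^sub>R (p $ \<Phi> x i, 1)"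
      using xq[of "Some i"] S[OF x] by (simp add: \<alpha>(2) linear_scale xp)
    then obtain j where j: "\<Psi> (cone_map x) (Some i) = Some j"
      using q0 \<alpha>(1)[of i] by (cases "\<Psi> (cone_map x) (Some i)") (auto simp: zero_prod_def)
    then have "j = \<Phi> x i" using q \<alpha>(1) by (intro inj(2)) (auto simp: \<alpha>(2))
    with j show ?thesis by simp
  qed
  ultimately show "\<Psi> (cone_map x) None = None \<and> (\<forall>i. \<Psi> (cone_map x) (Some i) = Some (\<Phi> x i))"
    by blast
qed

lemma symmetric_configs_cone_iff:
  assumes "cone_type S \<Phi> \<Psi>"
  shows "q \<in> symmetric_configs (cone_group S) \<Psi> \<longleftrightarrow>
    (\<forall>x\<in>S. cone_map x (q $ None) = q $ None \<and>
       (\<forall>i. cone_map x (q $ Some i) = q $ Some (\<Phi> x i)))"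
  using assms by (auto simp: symmetric_configs_def cone_group_def cone_type_def split_option_all)

lemma edge_form_cone_eq_0_iff:
  fixes E :: "'v::finite set set" and q v :: "('a::euclidean_space \<times> real) ^ 'v option"
  assumes "simple_graph (cone_graph E)"
  shows "edge_form (cone_graph E) q v = 0 \<longleftrightarrow>
    (\<forall>i. (q $ Some i - q $ None) \<bullet> (v $ Some i - v $ None) = 0) \<and>
    (\<forall>i j. {i, j} \<in> E \<longrightarrow> (q $ Some i - q $ Some j) \<bullet> (v $ Some i - v $ Some j) = 0)"
proof -
  have "{None, Some i} \<in> cone_graph E" "{Some i, None} \<in> cone_graph E" for i
    by (auto simp: cone_graph_def insert_commute)
  moreover have "{Some i, Some j} \<in> cone_graph E \<longleftrightarrow> {i, j} \<in> E" for i j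
  proof -
    have "inj (\<lambda>e :: 'v set. Some ` e)" by (auto intro!: injI simp: inj_image_eq_iff)
    then have "Some ` {i, j} \<in> (\<lambda>e. Some ` e) ` E \<longleftrightarrow> {i, j} \<in> E"
      by (rule inj_image_mem_iff)
    moreover have "{Some i, Some j} \<notin> range (\<lambda>i. {None, Some i})" by auto
    ultimately show ?thesis by (simp add: cone_graph_def)
  qed
  moreover have "(q $ None - q $ Some i) \<bullet> (v $ None - v $ Some i) =
      (q $ Some i - q $ None) \<bullet> (v $ Some i - v $ None)" for i
    by (simp add: inner_diff)
  ultimately show ?thesis
    by (auto simp: edge_form_eq_0_iff[OF assms] split_option_all)
qed

text \<open>
  The last coordinate of the \<open>i\<close>-th vertex relative to the cone vertex, and the projection of the
  \<open>i\<close>-th vertex from the cone vertex to height 1.  The cone vertex is not assumed to be at the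
  origin, since neighbouring configurations have to be considered as well.
\<close>
definition cone_height :: "('a::euclidean_space \<times> real) ^ 'v::finite option \<Rightarrow> 'v \<Rightarrow> real" where
  "cone_height q i = snd (q $ Some i - q $ None)"

definition cone_proj :: "('a::euclidean_space \<times> real) ^ 'v::finite option \<Rightarrow> 'a ^ 'v" where
  "cone_proj q = (\<chi> i. (1 / cone_height q i) *\<^sub>R fst (q $ Some i - q $ None))"

text \<open>
  The infinitesimal Pogorelov map: it sends a velocity \<open>u i\<close> of the projected point \<open>p i\<close> to a
  multiple of \<open>(u i, - p i \<bullet> u i)\<close>, which is orthogonal to the cone edge in direction \<open>(p i, 1)\<close>.
  For two vertices of heights \<open>h i\<close> and \<open>h j\<close>, the rate of change of the squared distance is
  multiplied by \<open>h i * h j\<close>.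
\<close>
definition cone_lift ::
    "('a::euclidean_space \<times> real) ^ 'v::finite option \<Rightarrow> 'a ^ 'v \<Rightarrow> ('a \<times> real) ^ 'v option" where
  "cone_lift q u = (\<chi> j. case j of None \<Rightarrow> 0
     | Some i \<Rightarrow> cone_height q i *\<^sub>R (u $ i, - (cone_proj q $ i \<bullet> u $ i)))"

lemma cone_lift_None [simp]: "cone_lift q u $ None = 0"
  and cone_lift_Some [simp]:
    "cone_lift q u $ Some i = cone_height q i *\<^sub>R (u $ i, - (cone_proj q $ i \<bullet> u $ i))"
  by (simp_all add: cone_lift_def)

lemma cone_edge_eq:
  assumes "cone_height q i \<noteq> 0"
  shows "q $ Some i - q $ None = cone_height q i *\<^sub>R (cone_proj q $ i, 1)"
  using assms by (simp add: prod_eq_iff cone_proj_def cone_height_def)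

lemma linear_cone_lift: "linear (cone_lift q)"
  by (rule linearI)
    (auto simp: vec_eq_iff split_option_all inner_add_right algebra_simps)

lemma inj_cone_lift:
  assumes "\<And>i. cone_height q i \<noteq> 0"
  shows "inj (cone_lift q)"
proof (rule injI)
  fix u w assume "cone_lift q u = cone_lift q w"
  then have "cone_lift q u $ Some i = cone_lift q w $ Some i" for i by simp
  then show "u = w" using assms by (simp add: vec_eq_iff)
qed

lemma cone_proj_symmetric:
  assumes type: "cone_type S \<Phi> \<Psi>" and S: "\<And>x. x \<in> S \<Longrightarrow> linear x"
    and q: "q \<in> symmetric_configs (cone_group S) \<Psi>" and x: "x \<in> S"
  shows "cone_height q (\<Phi> x i) = cone_height q i"
    and "x (cone_proj q $ i) = cone_proj q $ \<Phi> x i"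
proof -
  have q: "cone_map x (q $ None) = q $ None" "cone_map x (q $ Some i) = q $ Some (\<Phi> x i)"
    using q x by (auto simp: symmetric_configs_cone_iff[OF type])
  show h: "cone_height q (\<Phi> x i) = cone_height q i"
    unfolding cone_height_def q(2)[symmetric] by simp
  have "x (fst (q $ Some i - q $ None)) = fst (cone_map x (q $ Some i)) - fst (cone_map x (q $ None))"
    by (simp add: linear_diff[OF S[OF x]])
  also have "\<dots> = fst (q $ Some (\<Phi> x i) - q $ None)" by (simp only: q fst_diff)
  finally have "x (fst (q $ Some i - q $ None)) = fst (q $ Some (\<Phi> x i) - q $ None)" .
  then show "x (cone_proj q $ i) = cone_proj q $ \<Phi> x i"
    using S[OF x] by (simp add: cone_proj_def linear_scale h)
qed

lemma cone_lift_in_symmetric_inf_motions_iff: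
  fixes E :: "'v::finite set set" and q :: "('a::euclidean_space \<times> real) ^ 'v option"
  assumes E: "simple_graph E" "simple_graph (cone_graph E)"
    and type: "cone_type S \<Phi> \<Psi>" and S: "\<And>x. x \<in> S \<Longrightarrow> orthogonal_transformation x"
    and q: "q \<in> symmetric_configs (cone_group S) \<Psi>" and h: "\<And>i. cone_height q i \<noteq> 0"
  shows "cone_lift q u \<in> symmetric_inf_motions (cone_graph E) (cone_group S) \<Psi> q \<longleftrightarrow>
    u \<in> symmetric_inf_motions E S \<Phi> (cone_proj q)"
proof -
  let ?p = "cone_proj q" and ?h = "cone_height q"
  have lin: "linear x" if "x \<in> S" for x
    using S[OF that] by (simp add: orthogonal_transformation_def)
  have sym: "?h (\<Phi> x i) = ?h i" "x (?p $ i) = ?p $ \<Phi> x i" if "x \<in> S" for x i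
    using cone_proj_symmetric[OF type _ q that] lin by blast+
  have "cone_map x (cone_lift q u $ Some i) = cone_lift q u $ Some (\<Phi> x i) \<longleftrightarrow>
      x (u $ i) = u $ \<Phi> x i" if x: "x \<in> S" for x i
  proof -
    have "?p $ \<Phi> x i \<bullet> x (u $ i) = ?p $ i \<bullet> u $ i"
      using S[OF x] sym(2)[OF x, of i] by (metis orthogonal_transformation_def)
    then show ?thesis
      using h[of i] lin[OF x] by (auto simp: sym(1)[OF x] linear_scale)
  qed
  moreover have "cone_map x (0 :: 'a \<times> real) = 0" if "x \<in> S" for x
    using lin[OF that] by (simp add: prod_eq_iff linear_0)
  ultimately have "cone_lift q u \<in> symmetric_configs (cone_group S) \<Psi> \<longleftrightarrow>
      u \<in> symmetric_configs S \<Phi>"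
    unfolding symmetric_configs_cone_iff[OF type]
    by (simp add: symmetric_configs_def del: cone_lift_Some)
  moreover have "edge_form (cone_graph E) q (cone_lift q u) = 0 \<longleftrightarrow> edge_form E ?p u = 0"
  proof -
    have radial: "(q $ Some i - q $ None) \<bullet> (cone_lift q u $ Some i - cone_lift q u $ None) = 0" for i
      by (simp add: cone_edge_eq[OF h])
    have "(q $ Some i - q $ Some j) \<bullet> (cone_lift q u $ Some i - cone_lift q u $ Some j) =
        ?h i * ?h j * ((?p $ i - ?p $ j) \<bullet> (u $ i - u $ j))" for i j
    proof -
      have "q $ Some i - q $ Some j = (q $ Some i - q $ None) - (q $ Some j - q $ None)" by simp
      also have "\<dots> = ?h i *\<^sub>R (?p $ i, 1) - ?h j *\<^sub>R (?p $ j, 1)"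
        by (simp only: cone_edge_eq[OF h])
      finally have "q $ Some i - q $ Some j = ?h i *\<^sub>R (?p $ i, 1) - ?h j *\<^sub>R (?p $ j, 1)" .
      then show ?thesis
        by (simp add: inner_diff_left inner_diff_right algebra_simps)
    qed
    then show ?thesis
      using h by (simp only: edge_form_cone_eq_0_iff[OF E(2)] edge_form_eq_0_iff[OF E(1)] radial) simp
  qed
  ultimately show ?thesis by (simp add: symmetric_inf_motions_def)
qed

lemma cone_lift_surj:
  assumes E: "simple_graph (cone_graph E)" and h: "\<And>i. cone_height q i \<noteq> 0"
    and v: "edge_form (cone_graph E) q v = 0" and v0: "v $ None = 0"
  obtains u where "v = cone_lift q u"
proof
  let ?u = "\<chi> i. (1 / cone_height q i) *\<^sub>R fst (v $ Some i)"
  have "v $ Some i = cone_lift q ?u $ Some i" for i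
  proof -
    have "(q $ Some i - q $ None) \<bullet> v $ Some i = 0"
      using v v0 by (simp add: edge_form_cone_eq_0_iff[OF E])
    then have "cone_height q i *\<^sub>R (cone_proj q $ i, 1) \<bullet> v $ Some i = 0"
      by (simp only: cone_edge_eq[OF h])
    then have "cone_height q i * (cone_proj q $ i \<bullet> fst (v $ Some i) + snd (v $ Some i)) = 0"
      by (simp add: inner_prod_def distrib_left)
    then have "cone_proj q $ i \<bullet> fst (v $ Some i) + snd (v $ Some i) = 0"
      using h[of i] by (simp only: mult_eq_0_iff) simp
    then show ?thesis using h[of i] by (simp add: prod_eq_iff)
  qed
  then show "v = cone_lift q ?u" using v0 by (simp add: vec_eq_iff split_option_all)
qed

text \<open>The vectors fixed by all members of \<open>S\<close>; these are the symmetric translations.\<close>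
definition fixed_points :: "('a \<Rightarrow> 'a) set \<Rightarrow> 'a set" where
  "fixed_points S = {b. \<forall>x\<in>S. x b = b}"

lemma translation_in_symmetric_inf_motions:
  assumes "simple_graph E" "b \<in> fixed_points S"
  shows "(\<chi> i. b) \<in> symmetric_inf_motions E S \<Phi> p"
  using assms
  by (auto simp: symmetric_inf_motions_def symmetric_configs_def fixed_points_def
      edge_form_eq_0_iff)

lemma cone_vertex_in_fixed_points:
  assumes "cone_type S \<Phi> \<Psi>" "v \<in> symmetric_inf_motions (cone_graph E) (cone_group S) \<Psi> q"
  shows "v $ None \<in> fixed_points (cone_group S)"
proof -
  have "\<forall>x\<in>S. cone_map x (v $ None) = v $ None"
    using assms(2) by (simp add: symmetric_inf_motions_def symmetric_configs_cone_iff[OF assms(1)])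
  then show ?thesis by (simp add: fixed_points_def cone_group_def)
qed

text \<open>
  The infinitesimal motions of the cone with resting cone vertex are the lifts, and the velocity of
  the cone vertex is an arbitrary vector fixed by the symmetry group.
\<close>
lemma dim_symmetric_inf_motions_cone:
  fixes E :: "'v::finite set set" and q :: "('a::euclidean_space \<times> real) ^ 'v option"
  assumes E: "simple_graph E" "simple_graph (cone_graph E)"
    and type: "cone_type S \<Phi> \<Psi>" and S: "\<And>x. x \<in> S \<Longrightarrow> orthogonal_transformation x"
    and q: "q \<in> symmetric_configs (cone_group S) \<Psi>" and h: "\<And>i. cone_height q i \<noteq> 0"
  shows "dim (symmetric_inf_motions (cone_graph E) (cone_group S) \<Psi> q) =
    dim (symmetric_inf_motions E S \<Phi> (cone_proj q)) + dim (fixed_points (cone_group S))"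
proof -
  let ?M = "symmetric_inf_motions E S \<Phi> (cone_proj q)"
  let ?M' = "symmetric_inf_motions (cone_graph E) (cone_group S) \<Psi> q"
  have "linear y" if "y \<in> cone_group S" for y
    using orthogonal_cone_group[OF _ that] S by (auto simp: orthogonal_transformation_def)
  with E(2) have sub: "subspace ?M'" by (rule subspace_symmetric_inf_motions)
  have lift: "cone_lift q u \<in> ?M' \<longleftrightarrow> u \<in> ?M" for u
    using E type S q h by (rule cone_lift_in_symmetric_inf_motions_iff)
  have "cone_lift q ` ?M = {v \<in> ?M'. v $ None = 0}"
  proof
    show "cone_lift q ` ?M \<subseteq> {v \<in> ?M'. v $ None = 0}" using lift by auto
    show "{v \<in> ?M'. v $ None = 0} \<subseteq> cone_lift q ` ?M"
    proof
      fix v assume v: "v \<in> {v \<in> ?M'. v $ None = 0}"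
      then obtain u where "v = cone_lift q u"
        using cone_lift_surj[OF E(2) h, of v] by (auto simp: symmetric_inf_motions_def)
      then show "v \<in> cone_lift q ` ?M" using v lift by auto
    qed
  qed
  moreover have "dim (cone_lift q ` ?M) = dim ?M"
    using inj_cone_lift[OF h] by (intro dim_image_eq linear_cone_lift) (auto intro: inj_on_subset)
  moreover have "(\<lambda>v. v $ None) ` ?M' = fixed_points (cone_group S)"
  proof
    show "(\<lambda>v. v $ None) ` ?M' \<subseteq> fixed_points (cone_group S)"
      using cone_vertex_in_fixed_points[OF type] by blast
    show "fixed_points (cone_group S) \<subseteq> (\<lambda>v. v $ None) ` ?M'"
    proof
      fix b :: "'a \<times> real" assume "b \<in> fixed_points (cone_group S)"
      then have "(\<chi> i. b) \<in> ?M'" by (rule translation_in_symmetric_inf_motions[OF E(2)])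
      then show "b \<in> (\<lambda>v. v $ None) ` ?M'" by force
    qed
  qed
  moreover have "linear (\<lambda>v :: ('a \<times> real) ^ 'v option. v $ None)" by (simp add: linear_iff)
  from dim_kernel_plus_dim_image[OF this sub]
  have "dim {v \<in> ?M'. v $ None = 0} + dim ((\<lambda>v. v $ None) ` ?M') = dim ?M'" .
  ultimately show ?thesis by simp
qed

text \<open>
  The skew-symmetric maps of \<open>E\<^sup>d\<^sup>+\<^sup>1\<close> are exactly the block maps \<open>(a, s) \<mapsto> (A a + s b, - b \<bullet> a)\<close> with
  \<open>A\<close> skew-symmetric.  So rotations of the cone correspond to Euclidean motions of the base.
\<close>
lemma trivial_inf_motion_cone:
  fixes q :: "('a::euclidean_space \<times> real) ^ 'v::finite option"
  assumes S: "\<And>x. x \<in> S \<Longrightarrow> orthogonal_transformation x"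
    and q0: "q $ None = 0" and h: "\<And>i. cone_height q i \<noteq> 0"
    and c: "c \<in> fixed_points (cone_group S)"
    and u: "trivial_inf_motion S (cone_proj q) u"
  shows "trivial_inf_motion (cone_group S) q ((\<chi> i. c) + cone_lift q u)"
proof -
  obtain A b where A: "linear A" "\<And>v w. A v \<bullet> w = - (v \<bullet> A w)"
    "\<And>x v. x \<in> S \<Longrightarrow> A (x v) = x (A v)" "\<And>x. x \<in> S \<Longrightarrow> x b = b"
    "\<And>i. u $ i = A (cone_proj q $ i) + b"
    using u unfolding trivial_inf_motion_def by metis
  define B where "B z = (A (fst z) + snd z *\<^sub>R b, - (b \<bullet> fst z))" for z
  have B: "linear B"
    unfolding B_def using A(1)
    by (intro linearI) (auto simp: linear_add linear_scale inner_add_right algebra_simps)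
  have "B z \<bullet> w = - (z \<bullet> B w)" for z w
    using A(2)[of "fst z" "fst w"]
    by (simp add: B_def inner_prod_def inner_add_left inner_add_right inner_commute algebra_simps)
  moreover have "B (y z) = y (B z)" if "y \<in> cone_group S" for y z
  proof -
    obtain x where x: "x \<in> S" "y = cone_map x"
      using \<open>y \<in> cone_group S\<close> by (auto simp: cone_group_def)
    note ox = S[OF x(1), unfolded orthogonal_transformation_def]
    have "b \<bullet> x (fst z) = b \<bullet> fst z" using ox A(4)[OF x(1)] by metis
    then show ?thesis
      using ox A(3,4)[OF x(1)] by (simp add: B_def x(2) linear_add linear_scale)
  qed
  moreover have "((\<chi> i. c) + cone_lift q u) $ j = B (q $ j) + c" for j
  proof (cases j)
    case None
    then show ?thesis using linear_0[OF B] by (simp add: q0)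
  next
    case (Some i)
    have "cone_proj q $ i \<bullet> A (cone_proj q $ i) = 0"
      using A(2)[of "cone_proj q $ i" "cone_proj q $ i"] by (simp add: inner_commute)
    then have "(u $ i, - (cone_proj q $ i \<bullet> u $ i)) = B (cone_proj q $ i, 1)"
      by (simp add: B_def A(5) inner_add_right inner_commute)
    moreover have "q $ Some i = cone_height q i *\<^sub>R (cone_proj q $ i, 1)"
      using cone_edge_eq[OF h, of i] by (simp add: q0)
    ultimately have "cone_lift q u $ Some i = B (q $ Some i)"
      by (simp only: cone_lift_Some linear_scale[OF B])
    then show ?thesis by (simp add: Some del: cone_lift_Some)
  qed
  ultimately show ?thesis
    using B c unfolding trivial_inf_motion_def fixed_points_def by blast
qed

lemma trivial_inf_motion_of_cone:
  fixes q :: "('a::euclidean_space \<times> real) ^ 'v::finite option"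
  assumes S: "\<And>x. x \<in> S \<Longrightarrow> linear x"
    and q0: "q $ None = 0" and h: "\<And>i. cone_height q i \<noteq> 0"
    and v: "trivial_inf_motion (cone_group S) q (cone_lift q u)"
  shows "trivial_inf_motion S (cone_proj q) u"
proof -
  obtain B c where B: "linear B" "\<And>v w. B v \<bullet> w = - (v \<bullet> B w)"
    "\<And>x v. x \<in> S \<Longrightarrow> B (cone_map x v) = cone_map x (B v)"
    "\<And>j. cone_lift q u $ j = B (q $ j) + c"
    using v unfolding trivial_inf_motion_def cone_group_def by (metis imageI)
  have c: "c = 0" using B(4)[of None] linear_0[OF B(1)] by (simp add: q0)
  define A where "A a = fst (B (a, 0))" for a
  define b where "b = fst (B (0, 1))"
  have "linear A"
    unfolding A_def
  proof (rule linearI)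
    fix a a' :: 'a and r :: real
    show "fst (B (a + a', 0)) = fst (B (a, 0)) + fst (B (a', 0))"
      using linear_add[OF B(1), of "(a, 0)" "(a', 0)"] by simp
    show "fst (B (r *\<^sub>R a, 0)) = r *\<^sub>R fst (B (a, 0))"
      using linear_scale[OF B(1), of r "(a, 0)"] by simp
  qed
  moreover have "A v \<bullet> w = - (v \<bullet> A w)" for v w
    using B(2)[of "(v, 0)" "(w, 0)"] by (simp add: A_def inner_prod_def)
  moreover have "A (x v) = x (A v)" if "x \<in> S" for x v
    using B(3)[OF that, of "(v, 0)"] by (simp add: A_def)
  moreover have "x b = b" if "x \<in> S" for x
  proof -
    have "fst (B (cone_map x (0, 1))) = x (fst (B (0, 1)))"
      by (simp only: B(3)[OF that] fst_cone_map)
    then show ?thesis by (simp add: b_def linear_0[OF S[OF that]])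
  qed
  moreover have "u $ i = A (cone_proj q $ i) + b" for i
  proof -
    have "cone_height q i *\<^sub>R (u $ i, - (cone_proj q $ i \<bullet> u $ i)) = B (q $ Some i)"
      using B(4)[of "Some i"] c by simp
    also have "q $ Some i = cone_height q i *\<^sub>R (cone_proj q $ i, 1)"
      using cone_edge_eq[OF h, of i] by (simp add: q0)
    finally have "(u $ i, - (cone_proj q $ i \<bullet> u $ i)) = B (cone_proj q $ i, 1)"
      using h[of i] by (simp only: linear_scale[OF B(1)] scaleR_cancel_left) simp
    also have "\<dots> = B (cone_proj q $ i, 0) + B (0, 1)"
      by (simp flip: linear_add[OF B(1)])
    finally show ?thesis by (simp add: A_def b_def prod_eq_iff)
  qed
  ultimately show ?thesis unfolding trivial_inf_motion_def by blast
qed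

section \<open>Transfer of flexes\<close>

text \<open>
  The infinitesimal test for symmetric flexibility.  Only a local form of regularity is needed,
  which matters for the cone: configurations with a vertex at height 0 have no projection.
\<close>
lemma symmetric_finite_flex_iff:
  fixes p :: "'a::euclidean_space ^ 'v::finite"
  assumes E: "simple_graph E" and S: "\<And>x. x \<in> S \<Longrightarrow> orthogonal_transformation x"
    and \<Phi>: "\<And>x. x \<in> S \<Longrightarrow> bij (\<Phi> x)"
    and p: "p \<in> symmetric_configs S \<Phi>"
    and reg: "\<forall>\<^sub>F x in nhds p. x \<in> symmetric_configs S \<Phi> \<longrightarrow>
      dim (symmetric_inf_motions E S \<Phi> p) \<le> dim (symmetric_inf_motions E S \<Phi> x)"
  shows "(\<exists>y. symmetric_finite_flex E S \<Phi> p y) \<longleftrightarrow>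
    \<not> (\<forall>u\<in>symmetric_inf_motions E S \<Phi> p. trivial_inf_motion S p u)"
proof
  have "linear x" if "x \<in> S" for x using S[OF that] by (simp add: orthogonal_transformation_def)
  then show "\<not> (\<forall>u\<in>symmetric_inf_motions E S \<Phi> p. trivial_inf_motion S p u)"
    if "\<exists>y. symmetric_finite_flex E S \<Phi> p y"
    using no_symmetric_finite_flex[OF E _ p] that by blast
  show "\<exists>y. symmetric_finite_flex E S \<Phi> p y"
    if "\<not> (\<forall>u\<in>symmetric_inf_motions E S \<Phi> p. trivial_inf_motion S p u)"
  proof -
    from that obtain u where "u \<in> symmetric_inf_motions E S \<Phi> p" "\<not> trivial_inf_motion S p u"
      by blast
    with E S \<Phi> p reg show ?thesis by (rule symmetric_finite_flex_exists)
  qed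
qed

theorem theorem4p2:
  fixes S :: "('a::euclidean_space \<Rightarrow> 'a) set"
    and E :: "'v::finite set set"
    and p :: "'a ^ 'v"
    and q :: "('a \<times> real) ^ 'v option"
    and \<Phi> :: "('a \<Rightarrow> 'a) \<Rightarrow> 'v \<Rightarrow> 'v"
    and \<Psi> :: "('a \<times> real \<Rightarrow> 'a \<times> real) \<Rightarrow> 'v option \<Rightarrow> 'v option"
  assumes "symmetry_group S"
    and "symmetric_framework E S \<Phi> p"
    and "S_regular E S \<Phi> p"
    and "symmetric_framework (cone_graph E) (cone_group S) \<Psi> q"
    and "q $ None = 0"
    and "projects_to q p"
  shows "(\<exists>y. symmetric_finite_flex E S \<Phi> p y) \<longleftrightarrow>
         (\<exists>z. symmetric_finite_flex (cone_graph E) (cone_group S) \<Psi> q z)"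
proof -
  let ?M = "symmetric_inf_motions E S \<Phi>"
  let ?M' = "symmetric_inf_motions (cone_graph E) (cone_group S) \<Psi>"
  have S: "orthogonal_transformation x" if "x \<in> S" for x
    using assms(1) subgroup.subset[of S orthogonal_group] that
    by (auto simp: symmetry_group_def orthogonal_group_def)
  have S': "orthogonal_transformation y" if "y \<in> cone_group S" for y
    using S that by (rule orthogonal_cone_group)
  have lin: "linear x" if "x \<in> S" for x
    using S[OF that] by (simp add: orthogonal_transformation_def)
  have E: "simple_graph E" and p: "p \<in> symmetric_configs S \<Phi>"
    and \<Phi>: "\<And>x. x \<in> S \<Longrightarrow> bij (\<Phi> x)"
    using assms(2) by (auto simp: symmetric_framework_def framework_def graph_aut_def)
  have E': "simple_graph (cone_graph E)" and q: "q \<in> symmetric_configs (cone_group S) \<Psi>"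
    and \<Psi>: "\<And>y. y \<in> cone_group S \<Longrightarrow> bij (\<Psi> y)"
    using assms(4) by (auto simp: symmetric_framework_def framework_def graph_aut_def)
  have type: "cone_type S \<Phi> \<Psi>"
    using lin assms(2,4,5,6) by (rule cone_type_of_symmetric_frameworks)
  have h: "cone_height q i \<noteq> 0" and proj: "cone_proj q $ i = p $ i" for i
  proof -
    obtain \<alpha> where "\<alpha> \<noteq> 0" "q $ Some i = \<alpha> *\<^sub>R (p $ i, 1)"
      using assms(6) by (auto simp: projects_to_def)
    then show "cone_height q i \<noteq> 0" "cone_proj q $ i = p $ i"
      using assms(5) by (simp_all add: cone_proj_def cone_height_def)
  qed
  then have proj: "cone_proj q = p" by (simp add: vec_eq_iff)
  have reg: "dim (?M p) \<le> dim (?M x)" if "x \<in> symmetric_configs S \<Phi>" for x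
    using E lin assms(3) p that by (rule S_regular_imp_dim_le)
  have "\<forall>\<^sub>F x in nhds q. \<forall>i. cone_height x i \<noteq> 0"
    proof (rule eventually_all_finite)
    fix i
    have "((\<lambda>x. cone_height x i) \<longlongrightarrow> cone_height q i) (nhds q)"
      unfolding cone_height_def by (intro tendsto_intros filterlim_ident)
    then show "\<forall>\<^sub>F x in nhds q. cone_height x i \<noteq> 0"
      using h by (rule tendsto_imp_eventually_ne)
  qed
  then have reg': "\<forall>\<^sub>F x in nhds q. x \<in> symmetric_configs (cone_group S) \<Psi> \<longrightarrow>
      dim (?M' q) \<le> dim (?M' x)"
  proof (rule eventually_mono, intro impI)
    fix x assume hx: "\<forall>i. cone_height x i \<noteq> 0" and x: "x \<in> symmetric_configs (cone_group S) \<Psi>"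
    have "cone_proj x \<in> symmetric_configs S \<Phi>"
      using cone_proj_symmetric(2)[OF type _ x] lin by (simp add: symmetric_configs_def)
    then have "dim (?M p) \<le> dim (?M (cone_proj x))" by (rule reg)
    moreover have "dim (?M' x) = dim (?M (cone_proj x)) + dim (fixed_points (cone_group S))"
      using hx by (intro dim_symmetric_inf_motions_cone E E' type S x) auto
    moreover have "dim (?M' q) = dim (?M (cone_proj q)) + dim (fixed_points (cone_group S))"
      by (intro dim_symmetric_inf_motions_cone E E' type S q h)
    ultimately show "dim (?M' q) \<le> dim (?M' x)" by (simp add: proj)
  qed
  have lift: "cone_lift q u \<in> ?M' q \<longleftrightarrow> u \<in> ?M p" for u
    using cone_lift_in_symmetric_inf_motions_iff[OF E E' type S q h] by (simp add: proj)
  have sub': "subspace (?M' q)"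
    using E' S' by (intro subspace_symmetric_inf_motions) (auto simp: orthogonal_transformation_def)
  have "(\<forall>u\<in>?M p. trivial_inf_motion S p u) \<longleftrightarrow>
      (\<forall>v\<in>?M' q. trivial_inf_motion (cone_group S) q v)"
  proof (intro iffI ballI)
    fix v assume triv: "\<forall>u\<in>?M p. trivial_inf_motion S p u" and v: "v \<in> ?M' q"
    have c: "v $ None \<in> fixed_points (cone_group S)"
      using type v by (rule cone_vertex_in_fixed_points)
    \<comment> \<open>Subtracting a symmetric translation brings the cone vertex to rest.\<close>
    have w: "v - (\<chi> i. v $ None) \<in> ?M' q"
      by (intro subspace_diff sub' v translation_in_symmetric_inf_motions E' c)
    obtain u where u: "v - (\<chi> i. v $ None) = cone_lift q u"
    proof (rule cone_lift_surj[OF E' h])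
      show "edge_form (cone_graph E) q (v - (\<chi> i. v $ None)) = 0"
        using w by (simp add: symmetric_inf_motions_def)
    qed auto
    then have "u \<in> ?M p" using w lift by simp
    then have "trivial_inf_motion (cone_group S) q ((\<chi> i. v $ None) + cone_lift q u)"
      using triv by (intro trivial_inf_motion_cone S assms(5) h c) (auto simp: proj)
    then show "trivial_inf_motion (cone_group S) q v" by (simp flip: u)
  next
    fix u assume triv: "\<forall>v\<in>?M' q. trivial_inf_motion (cone_group S) q v" and "u \<in> ?M p"
    then have "trivial_inf_motion (cone_group S) q (cone_lift q u)" using lift by blast
    then have "trivial_inf_motion S (cone_proj q) u"
      by (intro trivial_inf_motion_of_cone lin assms(5) h)
    then show "trivial_inf_motion S p u" by (simp add: proj)
  qed
  moreover have "(\<exists>y. symmetric_finite_flex E S \<Phi> p y) \<longleftrightarrow>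
      \<not> (\<forall>u\<in>?M p. trivial_inf_motion S p u)"
    using reg by (intro symmetric_finite_flex_iff E S \<Phi> p) auto
  moreover have "(\<exists>z. symmetric_finite_flex (cone_graph E) (cone_group S) \<Psi> q z) \<longleftrightarrow>
      \<not> (\<forall>v\<in>?M' q. trivial_inf_motion (cone_group S) q v)"
    using E' S' \<Psi> q reg' by (rule symmetric_finite_flex_iff)
  ultimately show ?thesis by simp
qed

end
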